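(* Let $G$ be a finite non-abelian soluble group such that every proper quotient of $G$ is cyclic. Then $G=N{:}H$ (a semidirect product with normal subgroup $N$), where $N=(C_p)^f$ for some prime $p$ and integer $f\geqslant 1$, and $H$ is cyclic and acts faithfully and irreducibly on $N$. Moreover, the following hold: (i) $s(G)=|N|-\epsilon$ and $u(G)=|N|-1$, where $\epsilon=0$ if $|H|$ is a prime and $\epsilon=1$ otherwise. (ii) $\gamma_u(G)=2$ and $P_2(G)=1-|N|^{-1}$.
   Context: Let $G$ be a finite $2$-generated non-cyclic group. The spread $s(G)$ is the largest integer $k\geqslant 0$ such that for any nontrivial $x_1,\ldots,x_k\in G$ there exists $y\in G$ with $G=\langle x_i,y\rangle$ for all $i$. The uniform spread $u(G)$ is the largest integer $k\geqslant 0$ such that there is a conjugacy class $C$ of $G$ with the property that for any nontrivial $x_1,\ldots,x_k\in G$ there exists $y\in C$ with $G=\langle x_i,y\rangle$ for all $i$. A total dominating set (TDS) for $G$ is a set $S$ of nontrivial elements of $G$ such that for every nontrivial $x\in G$ there is $y\in S$ with $G=\langle x,y\rangle$. A uniform dominating set (UDS) is a TDS consisting of elements that are all conjugate in $G$. If $u(G)\geqslant 1$, the uniform domination number $\gamma_u(G)$ is the minimal size of a UDS for $G$. For $s\in G$ and a positive integer $c$, let $s^G$ be the conjugacy class of $s$ and let $P(G,s,c)=|\{(x_1,\ldots,x_c)\in (s^G)^c : \{x_1,\ldots,x_c\}\text{ is a UDS for }G\}|/|s^G|^c$. Set $P_c(G)=\max\{P(G,s,c): s\in G\}$. *)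

theory Defs
  imports "HOL-Algebra.Algebra" "HOL-Computational_Algebra.Primes" "HOL.Real"
begin

definition conj_class :: "('a, 'b) monoid_scheme \<Rightarrow> 'a \<Rightarrow> 'a set" where
  "conj_class G s = {g \<otimes>\<^bsub>G\<^esub> s \<otimes>\<^bsub>G\<^esub> inv\<^bsub>G\<^esub> g | g. g \<in> carrier G}"

text \<open>Throughout, a \<open>k\<close>-tuple is a function on \<open>{..<k}\<close>; repeated entries are allowed.\<close>

definition spread :: "('a, 'b) monoid_scheme \<Rightarrow> nat" where
  "spread G = (GREATEST k. \<forall>x \<in> {..<k} \<rightarrow> carrier G - {\<one>\<^bsub>G\<^esub>}.
     \<exists>y \<in> carrier G. \<forall>i<k. generate G {x i, y} = carrier G)"

definition uniform_spread :: "('a, 'b) monoid_scheme \<Rightarrow> nat" where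
  "uniform_spread G = (GREATEST k. \<exists>s \<in> carrier G.
     \<forall>x \<in> {..<k} \<rightarrow> carrier G - {\<one>\<^bsub>G\<^esub>}.
     \<exists>y \<in> conj_class G s. \<forall>i<k. generate G {x i, y} = carrier G)"

definition total_dominating_set :: "('a, 'b) monoid_scheme \<Rightarrow> 'a set \<Rightarrow> bool" where
  "total_dominating_set G S \<longleftrightarrow> S \<subseteq> carrier G - {\<one>\<^bsub>G\<^esub>} \<and>
     (\<forall>x \<in> carrier G - {\<one>\<^bsub>G\<^esub>}. \<exists>y \<in> S. generate G {x, y} = carrier G)"

definition uniform_dominating_set :: "('a, 'b) monoid_scheme \<Rightarrow> 'a set \<Rightarrow> bool" where
  "uniform_dominating_set G S \<longleftrightarrow> total_dominating_set G S \<and>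
     (\<forall>x \<in> S. \<forall>y \<in> S. y \<in> conj_class G x)"

text \<open>Only meaningful if a uniform dominating set exists, that is, if the uniform spread is
  at least 1; otherwise \<open>LEAST\<close> leaves the value unspecified.\<close>

definition uniform_domination_number :: "('a, 'b) monoid_scheme \<Rightarrow> nat" where
  "uniform_domination_number G =
     (LEAST n. \<exists>S. finite S \<and> uniform_dominating_set G S \<and> card S = n)"

definition uds_prob :: "('a, 'b) monoid_scheme \<Rightarrow> 'a \<Rightarrow> nat \<Rightarrow> real" where
  "uds_prob G s c =
     real (card {x \<in> {..<c} \<rightarrow>\<^sub>E conj_class G s. uniform_dominating_set G (x ` {..<c})})
       / real (card (conj_class G s)) ^ c"

definition max_uds_prob :: "('a, 'b) monoid_scheme \<Rightarrow> nat \<Rightarrow> real" where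
  "max_uds_prob G c = Max ((\<lambda>s. uds_prob G s c) ` carrier G)"

definition internal_semidirect_product ::
    "('a, 'b) monoid_scheme \<Rightarrow> 'a set \<Rightarrow> 'a set \<Rightarrow> bool" where
  "internal_semidirect_product G N H \<longleftrightarrow>
     N \<lhd> G \<and> subgroup H G \<and> N <#>\<^bsub>G\<^esub> H = carrier G \<and> N \<inter> H = {\<one>\<^bsub>G\<^esub>}"

definition conj_action :: "('a, 'b) monoid_scheme \<Rightarrow> 'a set \<Rightarrow> 'a \<Rightarrow> 'a \<Rightarrow> 'a" where
  "conj_action G N = (\<lambda>h. \<lambda>n \<in> N. h \<otimes>\<^bsub>G\<^esub> n \<otimes>\<^bsub>G\<^esub> inv\<^bsub>G\<^esub> h)"

text \<open>Used for \<open>N\<close> elementary abelian of exponent \<open>p\<close>: the subgroups of \<open>N\<close> are then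
  exactly its subspaces over the field with \<open>p\<close> elements, so this is irreducibility of \<open>N\<close> as
  a module for \<open>H\<close> over that field.\<close>

definition acts_irreducibly ::
    "('a, 'b) monoid_scheme \<Rightarrow> 'a set \<Rightarrow> 'a set \<Rightarrow> bool" where
  "acts_irreducibly G H N \<longleftrightarrow> N \<noteq> {\<one>\<^bsub>G\<^esub>} \<and>
     (\<forall>K. subgroup K G \<and> K \<subseteq> N \<and> (\<forall>h \<in> H. conj_action G N h ` K \<subseteq> K)
        \<longrightarrow> K = {\<one>\<^bsub>G\<^esub>} \<or> K = N)"

end

theory Submission
  imports Defs
begin

text \<open>
  \<open>N\<close> is the derived subgroup: proper quotients are abelian, so every nontrivial normal subgroup
  contains \<open>N\<close>, and solubility then makes \<open>N\<close> elementary abelian. If \<open>yN\<close> generates \<open>G/N\<close>, then the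
  centralizer in \<open>N\<close> of a nontrivial power \<open>h\<close> of \<open>y\<close> is normal in \<open>G\<close>, hence trivial, so
  \<open>n \<mapsto> n h n\<^sup>-\<^sup>1\<close> maps \<open>N\<close> bijectively onto \<open>N h\<close>. Thus \<open>G\<close> is a Frobenius group: \<open>G - N\<close> is partitioned by
  the nontrivial elements of the \<open>|N|\<close> conjugates of \<open>H = \<langle>y\<rangle>\<close>, and these conjugates are maximal. Hence
  an element \<open>x \<noteq> 1\<close> fails to generate \<open>G\<close> together with at most one of the \<open>|N|\<close> conjugates of
  \<open>y\<close>, which gives the lower bounds by pigeonhole, while one element from each conjugate of \<open>H\<close> blocks
  every element outside \<open>N\<close>. An element of \<open>N\<close> can only serve as a mate for elements generating \<open>G/N\<close>;
  when \<open>|H|\<close> is prime these are all the elements outside \<open>N\<close>, and this accounts for \<open>\<epsilon>\<close>.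
\<close>

section \<open>Elementary abelian groups\<close>

text \<open>The analogue of enlarging an independent family over the field with \<open>p\<close>
  elements: if a product of an element of the image with a power of \<open>x\<close> is trivial and
  the exponent is prime to \<open>p\<close>, then \<open>x\<close> itself lies in the image.\<close>

lemma (in comm_group) extend_mon_integer_mod_power:
  assumes p: "Factorial_Ring.prime (p::nat)"
    and exp: "\<And>x. x \<in> carrier G \<Longrightarrow> x [^] p = \<one>"
    and \<phi>: "\<phi> \<in> mon (product_group {..<f} (\<lambda>_. integer_mod_group p)) G"
    and x: "x \<in> carrier G" "x \<notin> \<phi> ` carrier (product_group {..<f} (\<lambda>_. integer_mod_group p))"
  shows "(\<lambda>e. \<phi> (restrict e {..<f}) \<otimes> x [^] (e f :: int))
    \<in> mon (product_group {..<Suc f} (\<lambda>_. integer_mod_group p)) G"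
    (is "?\<psi> \<in> mon ?P' G")
proof -
  let ?P = "product_group {..<f} (\<lambda>_. integer_mod_group p)"
  have p0: "p > 0" using p by (simp add: prime_gt_0_nat)
  interpret P: group ?P by simp
  interpret P': group ?P' by simp
  have "\<phi> \<in> hom ?P G" using \<phi> by (simp add: mon_def)
  then interpret \<phi>: group_hom ?P G \<phi>
    by (intro group_hom.intro group_hom_axioms.intro P.is_group is_group)
  have \<phi>1: "\<And>e. e \<in> carrier ?P \<Longrightarrow> \<phi> e = \<one> \<Longrightarrow> e = \<one>\<^bsub>?P\<^esub>"
    using \<phi> \<phi>.inj_on_one_iff by (auto simp: mon_def)
  \<comment> \<open>The new coordinate is added modulo \<open>p\<close>; exponent \<open>p\<close>
    makes this reduction harmless for powers of \<open>x\<close>.\<close>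
  have xp: "x [^] (k mod int p) = x [^] k" for k :: int
  proof -
    have "x [^] k = x [^] (int p * (k div int p) + k mod int p)" by simp
    also have "\<dots> = (x [^] int p) [^] (k div int p) \<otimes> x [^] (k mod int p)"
      using x by (simp only: int_pow_mult int_pow_pow)
    also have "\<dots> = x [^] (k mod int p)" using x exp[of x] by (simp add: int_pow_int)
    finally show ?thesis by simp
  qed
  have res: "restrict e {..<f} \<in> carrier ?P" if "e \<in> carrier ?P'" for e
    using that by (auto simp: PiE_iff)
  have hom: "?\<psi> \<in> hom ?P' G"
  proof (rule homI)
    fix e assume "e \<in> carrier ?P'"
    then show "?\<psi> e \<in> carrier G" using res x \<phi>.hom_closed by blast
  next
    fix d e assume d: "d \<in> carrier ?P'" and e: "e \<in> carrier ?P'"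
    have "restrict (d \<otimes>\<^bsub>?P'\<^esub> e) {..<f} = restrict d {..<f} \<otimes>\<^bsub>?P\<^esub> restrict e {..<f}"
      by (auto simp: fun_eq_iff)
    moreover have "(d \<otimes>\<^bsub>?P'\<^esub> e) f = (d f + e f) mod int p" by simp
    ultimately have "?\<psi> (d \<otimes>\<^bsub>?P'\<^esub> e)
        = (\<phi> (restrict d {..<f}) \<otimes> \<phi> (restrict e {..<f})) \<otimes> (x [^] d f \<otimes> x [^] e f)"
      using \<phi>.hom_mult[OF res[OF d] res[OF e]] x by (simp only: xp int_pow_mult)
    then show "?\<psi> (d \<otimes>\<^bsub>?P'\<^esub> e) = ?\<psi> d \<otimes> ?\<psi> e"
      using \<phi>.hom_closed[OF res[OF d]] \<phi>.hom_closed[OF res[OF e]] x by (simp add: m_ac)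
  qed
  interpret \<psi>: group_hom ?P' G ?\<psi>
    by (intro group_hom.intro group_hom_axioms.intro P'.is_group is_group hom)
  have "e = \<one>\<^bsub>?P'\<^esub>" if e: "e \<in> carrier ?P'" and 1: "?\<psi> e = \<one>" for e
  proof -
    have \<phi>c: "\<phi> (restrict e {..<f}) \<in> carrier G" using res[OF e] by (rule \<phi>.hom_closed)
    have inv: "x [^] e f = inv (\<phi> (restrict e {..<f}))"
      using 1 \<phi>c x by (metis int_pow_closed inv_equality m_comm)
    have range: "0 \<le> e f" "e f < int p"
      using e p0 by (auto simp: PiE_iff carrier_integer_mod_group)
    have ef: "e f = 0"
    proof (rule ccontr)
      assume "e f \<noteq> 0"
      then have "\<not> int p dvd e f" using range by (auto dest: zdvd_imp_le)
      then have "coprime (int p) (e f)" using p by (simp add: prime_imp_coprime)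
      then obtain u v where uv: "u * int p + v * e f = 1"
        by (metis bezout_int coprime_imp_gcd_eq_1)
      \<comment> \<open>By Bezout, \<open>x\<close> is a power of \<open>x [^] e f\<close>, which
        lies in the image of \<open>\<phi>\<close>.\<close>
      have "x = x [^] (int p * u + e f * v)" using uv x by (simp add: mult.commute)
      also have "\<dots> = (x [^] int p) [^] u \<otimes> (x [^] e f) [^] v"
        using x by (simp only: int_pow_mult int_pow_pow)
      also have "\<dots> = inv (\<phi> (restrict e {..<f})) [^] v"
        using x exp[of x] \<phi>c by (simp add: int_pow_int inv)
      also have "\<dots> \<in> \<phi> ` carrier ?P"
        using subgroup_int_pow_closed[OF \<phi>.img_is_subgroup] res[OF e]
          subgroup.m_inv_closed[OF \<phi>.img_is_subgroup] by blast
      finally show False using x by simp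
    qed
    with 1 \<phi>c have "\<phi> (restrict e {..<f}) = \<one>" by simp
    with \<phi>1 res[OF e] have "restrict e {..<f} = \<one>\<^bsub>?P\<^esub>" by blast
    then have "\<And>i. i < f \<Longrightarrow> e i = 0"
      by (auto simp: fun_eq_iff restrict_def split: if_splits)
    with ef e show ?thesis
      by (auto simp: fun_eq_iff restrict_def PiE_iff extensional_def less_Suc_eq)
  qed
  then show ?thesis using hom \<psi>.inj_on_one_iff by (auto simp: mon_def)
qed

text \<open>Embeddings of \<open>(C_p)^f\<close> have bounded rank, since
  \<open>f < p ^ f \<le> |G|\<close>. One of maximal rank is onto: an element outside its image
  would extend it.\<close>

lemma (in comm_group) elementary_abelian_iso:
  assumes fin: "finite (carrier G)" and p: "Factorial_Ring.prime (p::nat)"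
    and exp: "\<And>x. x \<in> carrier G \<Longrightarrow> x [^] p = \<one>"
  obtains f :: nat where "G \<cong> product_group {..<f} (\<lambda>_. integer_mod_group p)"
proof -
  let ?P = "\<lambda>f::nat. product_group {..<f} (\<lambda>_. integer_mod_group p)"
  let ?Q = "\<lambda>f. \<exists>\<phi>. \<phi> \<in> mon (?P f) G"
  have p1: "p > 1" using p by (rule prime_gt_1_nat)
  have "?Q 0"
    by (rule exI[of _ "\<lambda>_. \<one>"]) (auto simp: mon_def intro!: homI)
  moreover have "f \<le> card (carrier G)" if Q: "?Q f" for f
  proof -
    obtain \<phi> where "\<phi> \<in> mon (?P f) G" using Q by blast
    then have "inj_on \<phi> (carrier (?P f))" "\<phi> ` carrier (?P f) \<subseteq> carrier G"
      by (auto simp: mon_def hom_def)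
    then have "card (carrier (?P f)) \<le> card (carrier G)"
      using fin by (rule card_inj_on_le)
    moreover have "card (carrier (?P f)) = p ^ f"
      using p1 by (simp add: card_PiE carrier_integer_mod_group)
    moreover have "f < p ^ f" using p1 by (simp add: power_gt_expt)
    ultimately show ?thesis by linarith
  qed
  ultimately obtain f where Qf: "?Q f" and max: "\<And>f'. ?Q f' \<Longrightarrow> f' \<le> f"
    using Nat.ex_has_greatest_nat[of ?Q 0 "card (carrier G)"] by meson
  obtain \<phi> where \<phi>: "\<phi> \<in> mon (?P f) G" using Qf by blast
  have "carrier G \<subseteq> \<phi> ` carrier (?P f)"
    using extend_mon_integer_mod_power[OF p exp \<phi>] max[of "Suc f"] by fastforce
  moreover have "\<phi> ` carrier (?P f) \<subseteq> carrier G" using \<phi> by (auto simp: mon_def hom_def)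
  ultimately have "\<phi> \<in> iso (?P f) G"
    using \<phi> by (auto simp: mon_def iso_def bij_betw_def)
  then have "?P f \<cong> G" by (rule is_isoI)
  then have "G \<cong> ?P f" using group.iso_sym[of "?P f" G] by simp
  then show ?thesis by (rule that)
qed

section \<open>Conjugation and centralizers\<close>

lemma (in group) pow_conj:
  assumes "x \<in> carrier G" "y \<in> carrier G"
  shows "(x \<otimes> y \<otimes> inv x) [^] (i::nat) = x \<otimes> y [^] i \<otimes> inv x"
proof (induction i)
  case (Suc i)
  have "x \<otimes> y [^] i \<otimes> inv x \<otimes> (x \<otimes> y \<otimes> inv x) = x \<otimes> y [^] i \<otimes> (inv x \<otimes> x) \<otimes> y \<otimes> inv x"
    using assms by (simp only: m_assoc m_closed inv_closed nat_pow_closed)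
  with Suc show ?case using assms by (simp add: m_assoc)
qed (use assms in simp)

lemma (in group) conj_eq_self_iff:
  assumes "x \<in> carrier G" "y \<in> carrier G"
  shows "x \<otimes> y \<otimes> inv x = y \<longleftrightarrow> x \<otimes> y = y \<otimes> x"
  using assms by (metis inv_closed inv_solve_right m_closed)

lemma (in group) conj_conj:
  assumes "x \<in> carrier G" "y \<in> carrier G" "z \<in> carrier G"
  shows "(x \<otimes> y) \<otimes> z \<otimes> inv (x \<otimes> y) = x \<otimes> (y \<otimes> z \<otimes> inv y) \<otimes> inv x"
  using assms by (simp add: m_assoc inv_mult_group)

text \<open>For multiplying normal forms \<open>n \<otimes> y [^] i\<close> whose two parts
  commute.\<close>

lemma (in monoid) mult_mult_swap:
  assumes "a \<otimes> m = m \<otimes> a"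
    and [simp]: "a \<in> carrier G" "b \<in> carrier G" "m \<in> carrier G" "n \<in> carrier G"
  shows "(n \<otimes> a) \<otimes> (m \<otimes> b) = (n \<otimes> m) \<otimes> (a \<otimes> b)"
proof -
  have "(n \<otimes> a) \<otimes> (m \<otimes> b) = n \<otimes> (a \<otimes> m) \<otimes> b" by (simp add: m_assoc)
  then show ?thesis using assms(1) by (simp add: m_assoc)
qed

lemma (in group) subgroup_centralizer:
  assumes S: "S \<subseteq> carrier G"
  shows "subgroup {c \<in> carrier G. \<forall>s \<in> S. c \<otimes> s = s \<otimes> c} G" (is "subgroup ?C G")
proof (rule subgroupI)
  show "?C \<subseteq> carrier G" by auto
  have "\<one> \<in> ?C" using S by (auto simp: subset_iff)
  then show "?C \<noteq> {}" by blast
  fix a assume a: "a \<in> ?C"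
  have "inv a \<otimes> s = s \<otimes> inv a" if "s \<in> S" for s
  proof -
    have [simp]: "s \<in> carrier G" "a \<in> carrier G" using S that a by auto
    have as: "a \<otimes> s = s \<otimes> a" using a that by auto
    have "inv a \<otimes> s = inv a \<otimes> (s \<otimes> a) \<otimes> inv a" by (simp add: m_assoc)
    also have "\<dots> = s \<otimes> inv a" unfolding as[symmetric] by (simp add: m_assoc[symmetric])
    finally show ?thesis .
  qed
  then show "inv a \<in> ?C" using a by simp
  fix b assume b: "b \<in> ?C"
  have "(a \<otimes> b) \<otimes> s = s \<otimes> (a \<otimes> b)" if "s \<in> S" for s
  proof -
    have [simp]: "s \<in> carrier G" "a \<in> carrier G" "b \<in> carrier G" using S that a b by auto
    have as: "a \<otimes> s = s \<otimes> a" and bs: "b \<otimes> s = s \<otimes> b" using a b that by auto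
    have "(a \<otimes> b) \<otimes> s = (a \<otimes> s) \<otimes> b" by (simp add: m_assoc bs)
    then show ?thesis unfolding as by (simp add: m_assoc)
  qed
  then show "a \<otimes> b \<in> ?C" using a b by simp
qed

lemma (in group) commute_if_derived_trivial:
  assumes H: "H \<subseteq> carrier G" "derived G H = {\<one>}" and ab: "a \<in> H" "b \<in> H"
  shows "a \<otimes> b = b \<otimes> a"
proof -
  have ac: "a \<in> carrier G" and bc: "b \<in> carrier G" using H(1) ab by auto
  have "a \<otimes> b \<otimes> inv a \<otimes> inv b \<in> derived G H"
    unfolding derived_def using ab by (intro generate.incl) blast
  then have "a \<otimes> b \<otimes> inv a \<otimes> inv b = \<one>" using H(2) by simp
  then have "a \<otimes> b = \<one> \<otimes> b \<otimes> a" using ac bc by (metis inv_closed inv_inv inv_solve_right m_closed one_closed)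
  then show ?thesis using bc by simp
qed

lemma (in group) funpow_derived_fixed: "derived G H = H \<Longrightarrow> (derived G ^^ n) H = H"
  by (induction n) simp_all

section \<open>Groups with an abelian monolith\<close>

text \<open>\<open>N\<close> is an abelian least nontrivial normal subgroup. Cyclicity of
  \<open>G/N\<close> enters separately, as the existence of a supplement.\<close>

locale monolith = normal N G for N and G (structure) +
  assumes finite_carrier: "finite (carrier G)"
    and nonabelian: "\<not> comm_group G"
    and nontriv: "N \<noteq> {\<one>}"
    and N_comm: "x \<in> N \<Longrightarrow> y \<in> N \<Longrightarrow> x \<otimes> y = y \<otimes> x"
    and minimal: "K \<lhd> G \<Longrightarrow> K \<noteq> {\<one>} \<Longrightarrow> N \<subseteq> K"
begin

lemma one_in_N: "\<one> \<in> N" by (rule subgroup.one_closed[OF subgroup_axioms])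

lemma mult_in_N: "x \<in> N \<Longrightarrow> y \<in> N \<Longrightarrow> x \<otimes> y \<in> N"
  by (rule subgroup.m_closed[OF subgroup_axioms])

lemma inv_in_N: "x \<in> N \<Longrightarrow> inv x \<in> N"
  by (rule subgroup.m_inv_closed[OF subgroup_axioms])

text \<open>Equivalently, the coset of \<open>y\<close> generates \<open>G/N\<close>. The product
  form yields the normal form \<open>n \<otimes> y [^] k\<close> for all elements.\<close>

definition supplement :: "'a \<Rightarrow> bool" where
  "supplement y \<longleftrightarrow> y \<in> carrier G \<and> N <#> generate G {y} = carrier G"

lemma supplement_closed [simp]: "supplement y \<Longrightarrow> y \<in> carrier G"
  by (simp add: supplement_def)

lemma subgroup_cyclic: "y \<in> carrier G \<Longrightarrow> subgroup (generate G {y}) G"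
  by (simp add: generate_is_subgroup)

text \<open>Finite order makes natural exponents suffice, so that later arguments can use induction
  on the exponent.\<close>

lemma generate_nat_pow: "y \<in> carrier G \<Longrightarrow> generate G {y} = {y [^] k | k::nat. True}"
  using generate_pow_on_finite_carrier[OF finite_carrier] by simp

lemma supplementE:
  assumes "supplement y" "x \<in> carrier G"
  obtains n k where "n \<in> N" "x = n \<otimes> y [^] (k::nat)"
proof -
  have "x \<in> N <#> generate G {y}" using assms by (simp add: supplement_def)
  then obtain n h where n: "n \<in> N" and h: "h \<in> generate G {y}" and x: "x = n \<otimes> h"
    unfolding set_mult_def by blast
  obtain k where "h = y [^] (k::nat)"
    using h generate_nat_pow[OF supplement_closed[OF assms(1)]] by auto
  with n x that show ?thesis by simp
qed

lemma subgroup_mult_cyclic: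
  assumes "z \<in> carrier G"
  shows "subgroup (N <#> generate G {z}) G" "N \<subseteq> N <#> generate G {z}" "z \<in> N <#> generate G {z}"
proof -
  note sg = subgroup_cyclic[OF assms]
  show "subgroup (N <#> generate G {z}) G"
    using mult_norm_subgroup[OF normal_axioms sg] .
  show "N \<subseteq> N <#> generate G {z}"
  proof
    fix n assume n: "n \<in> N"
    have "n \<otimes> \<one> \<in> N <#> generate G {z}"
      unfolding set_mult_def using n subgroup.one_closed[OF sg] by blast
    then show "n \<in> N <#> generate G {z}" using mem_carrier[OF n] by simp
  qed
  have "z \<in> generate G {z}" by (simp add: generate.incl)
  then have "\<one> \<otimes> z \<in> N <#> generate G {z}"
    unfolding set_mult_def using one_in_N by blast
  then show "z \<in> N <#> generate G {z}" using assms by simp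
qed

lemma supplementI:
  assumes z: "z \<in> carrier G" and M: "\<And>M. subgroup M G \<Longrightarrow> N \<subseteq> M \<Longrightarrow> z \<in> M \<Longrightarrow> carrier G \<subseteq> M"
  shows "supplement z"
  using M[OF subgroup_mult_cyclic[OF z]] subgroup.subset[OF subgroup_mult_cyclic(1)[OF z]] z
  by (auto simp: supplement_def)

lemma supplement_incl:
  assumes y: "supplement y" and M: "subgroup M G" "N \<subseteq> M" "y \<in> M"
  shows "M = carrier G"
proof
  show "carrier G \<subseteq> M"
  proof
    fix x assume "x \<in> carrier G"
    then obtain n k where "n \<in> N" "x = n \<otimes> y [^] (k::nat)" using supplementE[OF y] by blast
    moreover have "y [^] k \<in> M"
      using subgroup_int_pow_closed[OF M(1,3), of "int k"] by (simp add: int_pow_int)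
    ultimately show "x \<in> M" using M subgroup.m_closed by fastforce
  qed
qed (rule subgroup.subset[OF M(1)])

lemma supplement_trans:
  assumes y: "supplement y" and z: "z \<in> carrier G"
    and M: "\<And>M. subgroup M G \<Longrightarrow> N \<subseteq> M \<Longrightarrow> z \<in> M \<Longrightarrow> y \<in> M"
  shows "supplement z"
proof (rule supplementI[OF z])
  fix M assume "subgroup M G" "N \<subseteq> M" "z \<in> M"
  then show "carrier G \<subseteq> M" using supplement_incl[OF y, of M] assms(3)[of M] by simp
qed

lemma not_supplement_if_in:
  assumes "x \<in> N"
  shows "\<not> supplement x"
proof
  assume "supplement x"
  then have "N = carrier G" using supplement_incl[OF _ subgroup_axioms subset_refl assms] by simp
  then have "comm_group G" using N_comm by (intro group_comm_groupI) auto
  then show False using nonabelian by simp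
qed

lemma finite_N: "finite N"
  by (rule finite_subset[OF subset finite_carrier])

lemma card_N: "card N > 1"
proof -
  have "{\<one>} \<subset> N" using nontriv one_in_N by (simp add: psubset_eq)
  then have "card {\<one>} < card N" by (rule psubset_card_mono[OF finite_N])
  then show ?thesis by simp
qed

lemma conj_in_N: "x \<in> carrier G \<Longrightarrow> n \<in> N \<Longrightarrow> x \<otimes> n \<otimes> inv x \<in> N"
  by (rule inv_op_closed2)

text \<open>The subgroup \<open>N\<close> acts trivially on itself, so normality in \<open>N\<langle>y\<rangle>\<close> only has to be tested
  against \<open>y\<close>.\<close>

lemma normal_in_N:
  assumes y: "supplement y" and K: "subgroup K G" "K \<subseteq> N"
    and inv: "\<And>k. k \<in> K \<Longrightarrow> y \<otimes> k \<otimes> inv y \<in> K"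
  shows "K \<lhd> G"
proof (rule normal_invI[OF K(1)])
  fix x k assume x: "x \<in> carrier G" and k: "k \<in> K"
  obtain n i where n: "n \<in> N" and x_eq: "x = n \<otimes> y [^] (i::nat)" using supplementE[OF y x] .
  have kc: "k \<in> carrier G" if "k \<in> K" for k using that K(1) subgroup.mem_carrier by fast
  have yi: "y [^] i \<otimes> k \<otimes> inv (y [^] i) \<in> K"
  proof (induction i)
    case 0 then show ?case using k kc by simp
  next
    case (Suc i)
    have "y [^] Suc i \<otimes> k \<otimes> inv (y [^] Suc i) = y \<otimes> (y [^] i \<otimes> k \<otimes> inv (y [^] i)) \<otimes> inv y"
      using conj_conj[of y "y [^] i" k] y k kc by (simp only: nat_pow_Suc2 supplement_closed nat_pow_closed)
    then show ?case using inv[OF Suc] by simp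
  qed
  have "x \<otimes> k \<otimes> inv x = n \<otimes> (y [^] i \<otimes> k \<otimes> inv (y [^] i)) \<otimes> inv n"
    unfolding x_eq using conj_conj n y kc k by simp
  also have "\<dots> = y [^] i \<otimes> k \<otimes> inv (y [^] i)"
    using conj_eq_self_iff[of n] N_comm[OF n] yi K(2) n mem_carrier by (meson subsetD)
  finally show "x \<otimes> k \<otimes> inv x \<in> K" using yi by simp
qed

section \<open>Fixed-point-free action of supplements on \<open>N\<close>\<close>

lemma supplement_not_centralizing:
  assumes y: "supplement y" and c: "\<And>n. n \<in> N \<Longrightarrow> n \<otimes> y = y \<otimes> n"
  shows False
proof -
  have c': "n \<otimes> y [^] k = y [^] k \<otimes> n" if "n \<in> N" for n and k :: nat
    using c[OF that] that y by (induction k) (simp_all add: mem_carrier m_assoc, metis m_assoc mem_carrier nat_pow_closed supplement_closed)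
  \<comment> \<open>With \<open>N\<close> abelian and centralized by \<open>y\<close>, any two
    normal forms commute, which would make \<open>G\<close> abelian.\<close>
  have "a \<otimes> b = b \<otimes> a" if a: "a \<in> carrier G" and b: "b \<in> carrier G" for a b
  proof -
    obtain n i where n: "n \<in> N" and a: "a = n \<otimes> y [^] (i::nat)" using supplementE[OF y a] .
    obtain m j where m: "m \<in> N" and b: "b = m \<otimes> y [^] (j::nat)" using supplementE[OF y b] .
    note [simp] = mem_carrier[OF n] mem_carrier[OF m] supplement_closed[OF y]
    have "a \<otimes> b = (n \<otimes> m) \<otimes> (y [^] i \<otimes> y [^] j)"
      unfolding a b using c'[OF m, of i] by (intro mult_mult_swap) simp_all
    also have "\<dots> = (m \<otimes> n) \<otimes> (y [^] j \<otimes> y [^] i)"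
      using N_comm[OF n m] by (simp add: nat_pow_mult add.commute)
    also have "\<dots> = b \<otimes> a"
      unfolding a b using c'[OF n, of j] by (intro mult_mult_swap[symmetric]) simp_all
    finally show ?thesis .
  qed
  then have "comm_group G" by (intro group_comm_groupI) auto
  then show False using nonabelian by simp
qed

text \<open>Such a \<open>z\<close> commutes with \<open>N\<close> and \<open>y\<close>, hence with
  all of \<open>G\<close>. A nontrivial centre would contain \<open>N\<close> by minimality, and
  then \<open>y\<close> would centralize \<open>N\<close>.\<close>

lemma center_trivial:
  assumes y: "supplement y" and z: "z \<in> carrier G" "\<And>n. n \<in> N \<Longrightarrow> z \<otimes> n = n \<otimes> z" "z \<otimes> y = y \<otimes> z"
  shows "z = \<one>"
proof (rule ccontr)
  assume z1: "z \<noteq> \<one>"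
  let ?Z = "{c \<in> carrier G. \<forall>x \<in> carrier G. c \<otimes> x = x \<otimes> c}"
  let ?C = "{x \<in> carrier G. \<forall>c \<in> {z}. x \<otimes> c = c \<otimes> x}"
  have "subgroup ?C G" using z(1) by (intro subgroup_centralizer) simp
  then have "?C = carrier G"
    by (rule supplement_incl[OF y]) (use z y mem_carrier in auto)
  then have C: "\<And>x. x \<in> carrier G \<Longrightarrow> x \<otimes> z = z \<otimes> x" by auto
  have "?Z \<lhd> G"
  proof (rule normal_invI[OF subgroup_centralizer[OF subset_refl]])
    fix x h assume x: "x \<in> carrier G" and h: "h \<in> ?Z"
    then have "x \<otimes> h \<otimes> inv x = h" using conj_eq_self_iff[of x h] by simp
    then show "x \<otimes> h \<otimes> inv x \<in> ?Z" using h by simp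
  qed
  moreover have "z \<in> ?Z" using z(1) C by simp
  ultimately have "N \<subseteq> ?Z" using minimal[of ?Z] z1 by (metis (no_types, lifting) singletonD)
  then have "n \<otimes> y = y \<otimes> n" if "n \<in> N" for n
    using subsetD[OF _ that, of ?Z] supplement_closed[OF y] by simp
  then show False using supplement_not_centralizing[OF y] by simp
qed

text \<open>The fixed points of \<open>y [^] i\<close> in \<open>N\<close> form a normal subgroup of
  \<open>G\<close>. If it is nontrivial, it is all of \<open>N\<close>, so \<open>y [^] i\<close>
  commutes with \<open>N\<close> and with \<open>y\<close> and must be trivial.\<close>

lemma fixed_point_free:
  assumes y: "supplement y" and yi: "y [^] (i::nat) \<noteq> \<one>" and n: "n \<in> N" "n \<otimes> y [^] i = y [^] i \<otimes> n"
  shows "n = \<one>"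
proof (rule ccontr)
  assume n1: "n \<noteq> \<one>"
  let ?h = "y [^] i"
  let ?K = "{m \<in> N. m \<otimes> ?h = ?h \<otimes> m}"
  have h: "?h \<in> carrier G" using y by simp
  have hy: "?h \<otimes> y = y \<otimes> ?h" using y by (metis nat_pow_Suc nat_pow_Suc2 supplement_closed)
  have "?K = N \<inter> {m \<in> carrier G. \<forall>c \<in> {?h}. m \<otimes> c = c \<otimes> m}" using mem_carrier by auto
  then have K: "subgroup ?K G"
    using subgroups_Inter_pair[OF subgroup_axioms subgroup_centralizer[of "{?h}"]] h by simp
  have "?K \<lhd> G"
  proof (rule normal_in_N[OF y K])
    fix k assume k: "k \<in> ?K"
    then have kc: "k \<in> carrier G" using mem_carrier by auto
    have yc: "y \<in> carrier G" using y by simp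
    \<comment> \<open>Conjugations by \<open>?h\<close> and \<open>y\<close> commute, so
      \<open>y\<close> permutes the fixed points of \<open>?h\<close>.\<close>
    have "?h \<otimes> (y \<otimes> k \<otimes> inv y) \<otimes> inv ?h = (?h \<otimes> y) \<otimes> k \<otimes> inv (?h \<otimes> y)"
      using conj_conj[OF h yc kc] by simp
    also have "\<dots> = y \<otimes> (?h \<otimes> k \<otimes> inv ?h) \<otimes> inv y"
      unfolding hy using conj_conj[OF yc h kc] by simp
    also have "?h \<otimes> k \<otimes> inv ?h = k" using conj_eq_self_iff[OF h kc] k by simp
    finally show "y \<otimes> k \<otimes> inv y \<in> ?K"
      using conj_eq_self_iff[of ?h "y \<otimes> k \<otimes> inv y"] h yc kc conj_in_N[OF yc] k by auto
  qed auto
  then have "N \<subseteq> ?K" using minimal n n1 by blast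
  then have "?h = \<one>" using center_trivial[OF y h _ hy] by fastforce
  with yi show False by simp
qed

text \<open>An element of the intersection commutes with \<open>y\<close> as a power of it and with
  \<open>N\<close> because \<open>N\<close> is abelian, so it is central.\<close>

lemma cyclic_Int_N:
  assumes y: "supplement y" and x: "x \<in> generate G {y}" "x \<in> N"
  shows "x = \<one>"
proof (rule center_trivial[OF y])
  obtain i where "x = y [^] (i::nat)" using x(1) generate_nat_pow[of y] y by auto
  then show "x \<otimes> y = y \<otimes> x" using y by (metis nat_pow_Suc nat_pow_Suc2 supplement_closed)
qed (use x N_comm mem_carrier in auto)

text \<open>If \<open>n\<close> and \<open>m\<close> give the same conjugate, then
  \<open>inv m \<otimes> n\<close> commutes with \<open>y [^] i\<close>.\<close>

lemma conj_pow_inj: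
  assumes y: "supplement y" and yi: "y [^] (i::nat) \<noteq> \<one>"
  shows "inj_on (\<lambda>n. n \<otimes> y [^] i \<otimes> inv n) N"
proof (rule inj_onI)
  fix n m assume n: "n \<in> N" and m: "m \<in> N" and eq: "n \<otimes> y [^] i \<otimes> inv n = m \<otimes> y [^] i \<otimes> inv m"
  note [simp] = mem_carrier[OF n] mem_carrier[OF m]
  have yc: "y \<in> carrier G" using y by simp
  have "(inv m \<otimes> n) \<otimes> y [^] i \<otimes> inv (inv m \<otimes> n) = inv m \<otimes> (m \<otimes> y [^] i \<otimes> inv m) \<otimes> inv (inv m)"
    using eq conj_conj[of "inv m" n "y [^] i"] yc by simp
  also have "\<dots> = y [^] i" using conj_conj[of "inv m" m "y [^] i"] yc by simp
  finally have "(inv m \<otimes> n) \<otimes> y [^] i = y [^] i \<otimes> (inv m \<otimes> n)"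
    using conj_eq_self_iff[of "inv m \<otimes> n" "y [^] i"] yc by simp
  then have "inv m \<otimes> n = \<one>" using fixed_point_free[OF y yi] n m by (simp add: mult_in_N inv_in_N)
  then show "n = m" by (metis inv_equality inv_inv mem_carrier m n inv_closed)
qed

lemma conj_in_coset:
  assumes "n \<in> N" "y \<in> carrier G"
  shows "\<exists>m \<in> N. n \<otimes> y \<otimes> inv n = m \<otimes> y"
proof
  show "n \<otimes> (y \<otimes> inv n \<otimes> inv y) \<in> N" using assms by (simp add: mult_in_N inv_in_N conj_in_N)
  show "n \<otimes> y \<otimes> inv n = n \<otimes> (y \<otimes> inv n \<otimes> inv y) \<otimes> y"
    using assms mem_carrier by (simp add: m_assoc)
qed

text \<open>The conjugates lie in the coset of \<open>y [^] i\<close>; by injectivity there are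
  \<open>|N|\<close> of them, which is the size of the coset.\<close>

lemma conj_pow_image:
  assumes y: "supplement y" and yi: "y [^] (i::nat) \<noteq> \<one>"
  shows "(\<lambda>n. n \<otimes> y [^] i \<otimes> inv n) ` N = (\<lambda>n. n \<otimes> y [^] i) ` N"
proof (rule card_subset_eq)
  show "finite ((\<lambda>n. n \<otimes> y [^] i) ` N)" using finite_N by simp
  show "(\<lambda>n. n \<otimes> y [^] i \<otimes> inv n) ` N \<subseteq> (\<lambda>n. n \<otimes> y [^] i) ` N"
  proof (rule image_subsetI)
    fix n assume "n \<in> N"
    then obtain m where "m \<in> N" "n \<otimes> y [^] i \<otimes> inv n = m \<otimes> y [^] i"
      using conj_in_coset[of n "y [^] i"] y by auto
    then show "n \<otimes> y [^] i \<otimes> inv n \<in> (\<lambda>n. n \<otimes> y [^] i) ` N" by simp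
  qed
  have "inj_on (\<lambda>n. n \<otimes> y [^] i) N"
    using y mem_carrier by (intro inj_onI) simp
  then show "card ((\<lambda>n. n \<otimes> y [^] i \<otimes> inv n) ` N) = card ((\<lambda>n. n \<otimes> y [^] i) ` N)"
    using conj_pow_inj[OF y yi] by (simp add: card_image)
qed

section \<open>The Frobenius partition and generation by pairs\<close>

lemma supplement_neq_one: "supplement y \<Longrightarrow> y \<noteq> \<one>"
  using not_supplement_if_in one_in_N by blast

lemma mem_cyclic_conj_iff:
  assumes "y \<in> carrier G" "n \<in> N"
  shows "x \<in> generate G {n \<otimes> y \<otimes> inv n} \<longleftrightarrow> (\<exists>i::nat. x = n \<otimes> y [^] i \<otimes> inv n)"
  using generate_nat_pow[of "n \<otimes> y \<otimes> inv n"] pow_conj[of n y] assms mem_carrier by auto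

lemma supplement_conj:
  assumes y: "supplement y" and n: "n \<in> N"
  shows "supplement (n \<otimes> y \<otimes> inv n)"
proof (rule supplement_trans[OF y])
  show "n \<otimes> y \<otimes> inv n \<in> carrier G" using y n mem_carrier by simp
  fix M assume M: "subgroup M G" "N \<subseteq> M" "n \<otimes> y \<otimes> inv n \<in> M"
  have "inv n \<otimes> (n \<otimes> y \<otimes> inv n) \<otimes> n \<in> M"
    using M n by (meson subgroup.m_closed subgroup.m_inv_closed subsetD)
  moreover have "inv n \<otimes> (n \<otimes> y \<otimes> inv n) \<otimes> n = y"
    using conj_conj[of "inv n" n y] y n mem_carrier by simp
  ultimately show "y \<in> M" by simp
qed

text \<open>Write \<open>x = n \<otimes> y [^] i\<close>. Since \<open>x\<close> is outside
  \<open>N\<close>, the power is nontrivial, and its whole coset consists of its conjugates under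
  \<open>N\<close>.\<close>

lemma cover:
  assumes y: "supplement y" and x: "x \<in> carrier G" "x \<notin> N"
  obtains n where "n \<in> N" "x \<in> generate G {n \<otimes> y \<otimes> inv n}"
proof -
  obtain n i where n: "n \<in> N" and x_eq: "x = n \<otimes> y [^] (i::nat)" using supplementE[OF y x(1)] .
  have "y [^] i \<noteq> \<one>" using x_eq x(2) n mem_carrier by auto
  then have "x \<in> (\<lambda>m. m \<otimes> y [^] i \<otimes> inv m) ` N"
    using conj_pow_image[OF y] n x_eq by simp
  then obtain m where m: "m \<in> N" "x = m \<otimes> y [^] i \<otimes> inv m" by (rule imageE)
  then have "x \<in> generate G {m \<otimes> y \<otimes> inv m}"
    using mem_cyclic_conj_iff[OF supplement_closed[OF y] m(1)] by auto
  with m(1) show ?thesis by (rule that)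
qed

text \<open>Let \<open>x\<close> be conjugate to \<open>y [^] i\<close> by \<open>n\<close> and to
  \<open>y [^] j\<close> by \<open>m\<close>. Both powers agree with \<open>x\<close> modulo
  \<open>N\<close>, so they are equal because the cyclic group meets \<open>N\<close> trivially;
  injectivity of conjugation then gives \<open>n = m\<close>.\<close>

lemma conj_cyclic_disjoint:
  assumes y: "supplement y" and n: "n \<in> N" and m: "m \<in> N" and x1: "x \<noteq> \<one>"
    and xn: "x \<in> generate G {n \<otimes> y \<otimes> inv n}" and xm: "x \<in> generate G {m \<otimes> y \<otimes> inv m}"
  shows "n = m"
proof -
  have yc: "y \<in> carrier G" using y by simp
  obtain i where i: "x = n \<otimes> y [^] (i::nat) \<otimes> inv n" using xn mem_cyclic_conj_iff[OF yc n] by blast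
  obtain j where j: "x = m \<otimes> y [^] (j::nat) \<otimes> inv m" using xm mem_cyclic_conj_iff[OF yc m] by blast
  obtain a where a: "a \<in> N" "x = a \<otimes> y [^] i" using conj_in_coset[OF n, of "y [^] i"] i yc by auto
  obtain b where b: "b \<in> N" "x = b \<otimes> y [^] j" using conj_in_coset[OF m, of "y [^] j"] j yc by auto
  have ac: "a \<in> carrier G" and bc: "b \<in> carrier G" using a b mem_carrier by simp_all
  have "y [^] i = inv a \<otimes> (b \<otimes> y [^] j)"
    using a b ac yc by (simp add: inv_solve_left)
  then have "y [^] i \<otimes> inv (y [^] j) = inv a \<otimes> b" using ac bc yc by (simp add: m_assoc)
  moreover have "y [^] i \<otimes> inv (y [^] j) \<in> generate G {y}"
    using subgroup.m_closed[OF subgroup_cyclic[OF yc]] subgroup.m_inv_closed[OF subgroup_cyclic[OF yc]]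
      generate_nat_pow[OF yc] by auto
  ultimately have "y [^] i \<otimes> inv (y [^] j) = \<one>" using cyclic_Int_N[OF y] a b by (simp add: mult_in_N inv_in_N)
  then have ij: "y [^] i = y [^] j" using yc by (metis inv_equality inv_inv inv_closed nat_pow_closed)
  have "y [^] i \<noteq> \<one>" using i x1 mem_carrier[OF n] by auto
  then show ?thesis using conj_pow_inj[OF y] i j ij n m by (metis (no_types, lifting) inj_onD)
qed

text \<open>This is maximality of the complement. In \<open>x = n \<otimes> y [^] i\<close> the
  factor \<open>n\<close> is nontrivial and lies in \<open>?M\<close>. Then
  \<open>?M \<inter> N\<close> is normalized by \<open>y\<close>, hence normal in \<open>G\<close>,
  so it contains \<open>N\<close>.\<close>

lemma generate_eq_carrier:
  assumes y: "supplement y" and x: "x \<in> carrier G" "x \<notin> generate G {y}"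
  shows "generate G {x, y} = carrier G"
proof -
  let ?M = "generate G {x, y}"
  have yc: "y \<in> carrier G" using y by simp
  have M: "subgroup ?M G" using x(1) yc by (simp add: generate_is_subgroup)
  have xM: "x \<in> ?M" and yM: "y \<in> ?M" by (simp_all add: generate.incl)
  have yk: "y [^] k \<in> ?M" for k :: nat
    using subgroup_int_pow_closed[OF M yM, of "int k"] by (simp add: int_pow_int)
  obtain n i where n: "n \<in> N" and x_eq: "x = n \<otimes> y [^] (i::nat)" using supplementE[OF y x(1)] .
  have "n = x \<otimes> inv (y [^] i)" using x_eq yc mem_carrier[OF n] by (simp add: inv_solve_right)
  then have nM: "n \<in> ?M" using M xM yk by (simp add: subgroup.m_closed subgroup.m_inv_closed)
  have n1: "n \<noteq> \<one>" using x_eq x(2) generate_nat_pow[OF yc] yc by auto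
  have K: "subgroup (?M \<inter> N) G" using M subgroup_axioms subgroups_Inter_pair by blast
  have "?M \<inter> N \<lhd> G"
    by (rule normal_in_N[OF y K])
      (use M yM conj_in_N[OF yc] in \<open>auto simp: subgroup.m_closed subgroup.m_inv_closed\<close>)
  then have "N \<subseteq> ?M" using minimal nM n n1 by blast
  then show ?thesis using supplement_incl[OF y M _ yM] by simp
qed

lemma cyclic_neq_carrier:
  assumes "supplement y"
  shows "generate G {y} \<noteq> carrier G"
  using cyclic_Int_N[OF assms] subset nontriv one_in_N by blast

lemma generate_neq_carrier:
  assumes "supplement z" "x \<in> generate G {z}" "y \<in> generate G {z}"
  shows "generate G {x, y} \<noteq> carrier G"
  using generate_subgroup_incl[OF _ subgroup_cyclic, of "{x, y}" z] cyclic_neq_carrier[of z]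
    generate_incl[of "{z}"] assms by auto

text \<open>Modulo \<open>N\<close> the generator \<open>y\<close> disappears, so \<open>x\<close>
  alone generates the quotient.\<close>

lemma supplement_if_generate:
  assumes "generate G {x, y} = carrier G" "x \<in> carrier G" "y \<in> N"
  shows "supplement x"
proof (rule supplementI[OF assms(2)])
  fix M assume "subgroup M G" "N \<subseteq> M" "x \<in> M"
  then show "carrier G \<subseteq> M" using generate_subgroup_incl[of "{x, y}" M] assms by auto
qed

text \<open>For a conjugator \<open>n \<otimes> y [^] i\<close>, the power of \<open>y\<close> acts
  trivially on \<open>y\<close>, so only \<open>n\<close> matters. With \<open>conj_inj\<close> this
  parametrizes the class by \<open>N\<close>.\<close>

lemma conj_class_supplement:
  assumes y: "supplement y"
  shows "conj_class G y = (\<lambda>n. n \<otimes> y \<otimes> inv n) ` N"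
proof
  show "(\<lambda>n. n \<otimes> y \<otimes> inv n) ` N \<subseteq> conj_class G y"
    using mem_carrier by (auto simp: conj_class_def)
  have yc: "y \<in> carrier G" using y by simp
  show "conj_class G y \<subseteq> (\<lambda>n. n \<otimes> y \<otimes> inv n) ` N"
  proof
    fix z assume "z \<in> conj_class G y"
    then obtain x where x: "x \<in> carrier G" "z = x \<otimes> y \<otimes> inv x" by (auto simp: conj_class_def)
    obtain n i where n: "n \<in> N" and x_eq: "x = n \<otimes> y [^] (i::nat)" using supplementE[OF y x(1)] .
    have "y [^] i \<otimes> y \<otimes> inv (y [^] i) = y"
      using conj_eq_self_iff[of "y [^] i" y] yc by (metis nat_pow_Suc nat_pow_Suc2 nat_pow_closed)
    then have "z = n \<otimes> y \<otimes> inv n"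
      using x(2) x_eq conj_conj[of n "y [^] i" y] n yc mem_carrier by simp
    then show "z \<in> (\<lambda>n. n \<otimes> y \<otimes> inv n) ` N" using n by blast
  qed
qed

lemma conj_inj: "supplement y \<Longrightarrow> inj_on (\<lambda>n. n \<otimes> y \<otimes> inv n) N"
  using conj_pow_inj[of y 1] supplement_neq_one by simp

lemma card_conj_class: "supplement y \<Longrightarrow> card (conj_class G y) = card N"
  by (simp add: conj_class_supplement card_image conj_inj)

section \<open>Spread, domination and uniform dominating pairs\<close>

lemma conj_class_sym:
  assumes "y \<in> carrier G" "z \<in> conj_class G y"
  shows "y \<in> conj_class G z"
proof -
  obtain x where x: "x \<in> carrier G" "z = x \<otimes> y \<otimes> inv x" using assms(2) by (auto simp: conj_class_def)
  have "y = inv x \<otimes> z \<otimes> inv (inv x)"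
    using conj_conj[of "inv x" x y] x assms(1) by simp
  then show ?thesis using x(1) inv_closed unfolding conj_class_def by blast
qed

lemma conj_class_self: "y \<in> carrier G \<Longrightarrow> y \<in> conj_class G y"
  unfolding conj_class_def by (rule CollectI, rule exI[of _ \<one>]) simp

lemma supplement_conj_class:
  assumes "supplement y" "z \<in> conj_class G y"
  shows "supplement z"
  using conj_class_supplement[OF assms(1)] assms(2) supplement_conj[OF assms(1)] by auto

lemma conj_class_closed: "y \<in> carrier G \<Longrightarrow> z \<in> conj_class G y \<Longrightarrow> z \<in> carrier G"
  by (auto simp: conj_class_def)

lemma conj_class_in_N: "s \<in> N \<Longrightarrow> y \<in> conj_class G s \<Longrightarrow> y \<in> N"
  unfolding conj_class_def using conj_in_N by (elim CollectE exE conjE) simp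

lemma nontrivial_in_N: obtains a where "a \<in> N" "a \<noteq> \<one>"
proof -
  have "\<not> N \<subseteq> {\<one>}" using nontriv one_in_N by auto
  then show ?thesis using that by (simp add: subset_iff) metis
qed

text \<open>Pigeonhole: each nontrivial \<open>x i\<close> rules out at most one of the
  \<open>|N|\<close> conjugates, so fewer than \<open>|N|\<close> elements leave one free.\<close>

lemma avoid_conj_cyclic:
  assumes y: "supplement y" and I: "finite I" "card I < card N" and x: "\<And>i. i \<in> I \<Longrightarrow> x i \<noteq> \<one>"
  obtains n where "n \<in> N" "\<And>i. i \<in> I \<Longrightarrow> x i \<notin> generate G {n \<otimes> y \<otimes> inv n}"
proof -
  let ?B = "\<lambda>i. {n \<in> N. x i \<in> generate G {n \<otimes> y \<otimes> inv n}}"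
  have "card (?B i) \<le> 1" if "i \<in> I" for i
  proof -
    have "\<forall>n \<in> ?B i. \<forall>m \<in> ?B i. n = m"
      using conj_cyclic_disjoint[OF y _ _ x[OF that]] by simp
    then show ?thesis using finite_N by (simp add: card_le_Suc0_iff_eq)
  qed
  then have "(\<Sum>i\<in>I. card (?B i)) \<le> card I" using sum_bounded_above[of I "\<lambda>i. card (?B i)" 1] by simp
  then have "card (\<Union>i\<in>I. ?B i) < card N" using card_UN_le[OF I(1), of ?B] I(2) by linarith
  moreover have "finite (\<Union>i\<in>I. ?B i)" using I(1) finite_N by simp
  ultimately have "\<not> N \<subseteq> (\<Union>i\<in>I. ?B i)" using card_mono[of "\<Union>i\<in>I. ?B i" N] by linarith
  then have "\<exists>n \<in> N. n \<notin> (\<Union>i\<in>I. ?B i)" by (simp only: subset_iff Bex_def not_all not_imp)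
  then obtain n where "n \<in> N" "n \<notin> (\<Union>i\<in>I. ?B i)" by (rule bexE)
  then show ?thesis by (intro that[of n]) simp_all
qed

section \<open>Blocking tuples and the uniform spread\<close>

lemma conj_class_mates:
  assumes g: "supplement g" and k: "k < card N" and x: "x \<in> {..<k} \<rightarrow> carrier G - {\<one>}"
  obtains y where "y \<in> conj_class G g" "\<And>i. i < k \<Longrightarrow> generate G {x i, y} = carrier G"
proof -
  have xi: "x i \<in> carrier G" "x i \<noteq> \<one>" if "i < k" for i using x that by (auto simp: Pi_iff)
  obtain n where n: "n \<in> N" "\<And>i. i \<in> {..<k} \<Longrightarrow> x i \<notin> generate G {n \<otimes> g \<otimes> inv n}"
    using avoid_conj_cyclic[OF g, of "{..<k}" x] k xi by auto
  have "n \<otimes> g \<otimes> inv n \<in> conj_class G g" using conj_class_supplement[OF g] n(1) by simp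
  moreover have "generate G {x i, n \<otimes> g \<otimes> inv n} = carrier G" if "i < k" for i
    using generate_eq_carrier[OF supplement_conj[OF g n(1)] xi(1)[OF that]] n(2) that by simp
  ultimately show ?thesis by (rule that)
qed

text \<open>The source of all upper bounds. Each conjugate of the cyclic group contains an entry,
  and every \<open>y\<close> outside \<open>N\<close> lies in one of these proper subgroups. The
  last two conclusions serve to exclude mates inside \<open>N\<close>.\<close>

lemma blocking_tuple:
  assumes g: "supplement g" and h: "h \<in> generate G {g}" "h \<noteq> \<one>" and k: "card N \<le> k"
  obtains x where "x \<in> {..<k} \<rightarrow> carrier G - {\<one>}"
    and "\<And>y. y \<in> carrier G - N \<Longrightarrow> \<exists>i<k. generate G {x i, y} \<noteq> carrier G"
    and "\<exists>n \<in> N. x 0 = n \<otimes> h \<otimes> inv n"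
    and "card N < k \<Longrightarrow> x (card N) \<in> N"
proof -
  obtain b where b: "bij_betw b {0..<card N} N" using ex_bij_betw_nat_finite[OF finite_N] by blast
  obtain a where a: "a \<in> N" "a \<noteq> \<one>" by (rule nontrivial_in_N)
  have gc: "g \<in> carrier G" using g by simp
  obtain j where j: "h = g [^] (j::nat)" using h(1) generate_nat_pow[OF gc] by auto
  have hc: "h \<in> carrier G" using j gc by simp
  \<comment> \<open>The first \<open>|N|\<close> entries run over the conjugates of \<open>h\<close>
    under \<open>N\<close>; the remaining ones are padding by a nontrivial element of
    \<open>N\<close>.\<close>
  define x where "x i = (if i < card N then b i \<otimes> h \<otimes> inv (b i) else a)" for i
  have bN: "b i \<in> N" if "i < card N" for i using b that by (auto simp: bij_betw_def)
  show ?thesis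
  proof (rule that[of x])
    show "x \<in> {..<k} \<rightarrow> carrier G - {\<one>}"
    proof
      fix i
      have "b i \<otimes> h \<otimes> inv (b i) \<noteq> \<one>" if "i < card N"
      proof
        assume "b i \<otimes> h \<otimes> inv (b i) = \<one>"
        moreover have "inv (b i) \<otimes> (b i \<otimes> h \<otimes> inv (b i)) \<otimes> inv (inv (b i)) = h"
          using conj_conj[of "inv (b i)" "b i" h] hc bN[OF that] mem_carrier by simp
        ultimately show False using h(2) bN[OF that] mem_carrier by simp
      qed
      then show "x i \<in> carrier G - {\<one>}" using a bN[of i] hc mem_carrier by (simp add: x_def)
    qed
    show "\<exists>n \<in> N. x 0 = n \<otimes> h \<otimes> inv n" using bN[of 0] card_N by (auto simp: x_def)
    show "x (card N) \<in> N" using a by (simp add: x_def)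
    fix y assume y: "y \<in> carrier G - N"
    then obtain n where n: "n \<in> N" "y \<in> generate G {n \<otimes> g \<otimes> inv n}" using cover[OF g, of y] by auto
    have "n \<in> b ` {0..<card N}" using b n(1) by (simp add: bij_betw_def)
    then obtain i where i: "i < card N" "n = b i" by auto
    have "x i \<in> generate G {n \<otimes> g \<otimes> inv n}"
      using mem_cyclic_conj_iff[OF gc n(1)] i j by (auto simp: x_def)
    then have "generate G {x i, y} \<noteq> carrier G"
      using generate_neq_carrier[OF supplement_conj[OF g n(1)]] n(2) by simp
    then show "\<exists>i<k. generate G {x i, y} \<noteq> carrier G" using i(1) k by (intro exI[of _ i]) simp
  qed
qed

text \<open>The class of \<open>g\<close> attains the value. For the upper bound, a class lies
  inside \<open>N\<close> or misses it: in the first case a constant tuple from \<open>N\<close> has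
  no mate, in the second the blocking tuple built from \<open>g\<close> has none.\<close>

lemma uniform_spread_eq:
  assumes g: "supplement g"
  shows "uniform_spread G = card N - 1"
  unfolding uniform_spread_def
proof (rule Greatest_equality)
  show "\<exists>s\<in>carrier G. \<forall>x\<in>{..<card N - 1} \<rightarrow> carrier G - {\<one>}.
      \<exists>y\<in>conj_class G s. \<forall>i<card N - 1. generate G {x i, y} = carrier G"
  proof (rule bexI[of _ g], rule ballI)
    fix x assume "x \<in> {..<card N - 1} \<rightarrow> carrier G - {\<one>}"
    moreover have "card N - 1 < card N" using card_N by simp
    ultimately obtain y where "y \<in> conj_class G g" "\<And>i. i < card N - 1 \<Longrightarrow> generate G {x i, y} = carrier G"
      using conj_class_mates[OF g] by metis
    then show "\<exists>y\<in>conj_class G g. \<forall>i<card N - 1. generate G {x i, y} = carrier G" by blast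
  qed (use g in simp)
next
  fix k :: nat
  assume "\<exists>s\<in>carrier G. \<forall>x\<in>{..<k} \<rightarrow> carrier G - {\<one>}.
      \<exists>y\<in>conj_class G s. \<forall>i<k. generate G {x i, y} = carrier G"
  then obtain s where s: "s \<in> carrier G" and mates: "\<And>x. x\<in>{..<k} \<rightarrow> carrier G - {\<one>} \<Longrightarrow>
      \<exists>y\<in>conj_class G s. \<forall>i<k. generate G {x i, y} = carrier G" by blast
  show "k \<le> card N - 1"
  proof (rule ccontr)
    assume "\<not> k \<le> card N - 1"
    then have k: "card N \<le> k" by simp
    show False
    proof (cases "s \<in> N")
      case True
      obtain a where a: "a \<in> N" "a \<noteq> \<one>" by (rule nontrivial_in_N)
      have "(\<lambda>_. a) \<in> {..<k} \<rightarrow> carrier G - {\<one>}" using a mem_carrier by simp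
      from mates[OF this] obtain y where "y \<in> conj_class G s" "generate G {a, y} = carrier G"
        using k card_N by (metis less_le_trans less_trans zero_less_one)
      then have "supplement a" using supplement_if_generate conj_class_in_N[OF True] a mem_carrier by simp
      then show False using not_supplement_if_in a by simp
    next
      case False
      obtain x where x: "x \<in> {..<k} \<rightarrow> carrier G - {\<one>}"
        "\<And>y. y \<in> carrier G - N \<Longrightarrow> \<exists>i<k. generate G {x i, y} \<noteq> carrier G"
        using blocking_tuple[OF g generate.incl[OF singletonI] supplement_neq_one[OF g] k] by metis
      from mates[OF x(1)] obtain y where y: "y \<in> conj_class G s" "\<forall>i<k. generate G {x i, y} = carrier G"
        by blast
      have "y \<notin> N" using conj_class_in_N[OF _ conj_class_sym[OF s y(1)]] False by blast
      then show False using x(2)[of y] y conj_class_closed[OF s y(1)] by blast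
    qed
  qed
qed

section \<open>The spread, according to primality of the complement's order\<close>

lemma spread_lower:
  assumes g: "supplement g" and x: "x \<in> {..<card N - 1} \<rightarrow> carrier G - {\<one>}"
  shows "\<exists>y \<in> carrier G. \<forall>i<card N - 1. generate G {x i, y} = carrier G"
proof -
  have "card N - 1 < card N" using card_N by simp
  then obtain y where "y \<in> conj_class G g" "\<And>i. i < card N - 1 \<Longrightarrow> generate G {x i, y} = carrier G"
    using conj_class_mates[OF g _ x] by metis
  then show ?thesis using conj_class_closed[of g y] g by auto
qed

lemma ord_supplement_gt_1:
  assumes "supplement g"
  shows "ord g > 1"
proof -
  have "ord g \<noteq> 1" using ord_eq_1[of g] supplement_neq_one[OF assms] assms by simp
  moreover have "ord g > 0" using ord_ge_1[OF finite_carrier, of g] assms by simp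
  ultimately show ?thesis by simp
qed

text \<open>In \<open>g = m \<otimes> h [^] j\<close> the factor \<open>m\<close> lies in both
  \<open>N\<close> and the cyclic group of \<open>g\<close>, so it is trivial. Hence an element
  generating a smaller subgroup of that cyclic group is no supplement.\<close>

lemma supplement_mem_cyclic:
  assumes g: "supplement g" and h: "h \<in> generate G {g}" "supplement h"
  shows "g \<in> generate G {h}"
proof -
  have gc: "g \<in> carrier G" and hc: "h \<in> carrier G" using g h by simp_all
  obtain m j where m: "m \<in> N" and eq: "g = m \<otimes> h [^] (j::nat)" using supplementE[OF h(2) gc] .
  have m_eq: "m = g \<otimes> inv (h [^] j)" using eq hc mem_carrier[OF m] by (simp add: inv_solve_right)
  have "h [^] j \<in> generate G {g}"
    using subgroup_int_pow_closed[OF subgroup_cyclic[OF gc] h(1), of "int j"] by (simp add: int_pow_int)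
  then have "m \<in> generate G {g}" unfolding m_eq
    using subgroup.m_closed[OF subgroup_cyclic[OF gc]] subgroup.m_inv_closed[OF subgroup_cyclic[OF gc]]
      generate.incl[of g "{g}" G] by simp
  then have "m = \<one>" using cyclic_Int_N[OF g _ m] by simp
  then have "g = h [^] j" using eq hc by simp
  then show ?thesis using generate_nat_pow[OF hc] by auto
qed

text \<open>If the \<open>|N|\<close> entries miss a conjugate of the cyclic group, that conjugate
  supplies a mate. Otherwise each entry lies in its own conjugate and, by primality, generates it;
  then any nontrivial element of \<open>N\<close> is a mate. For the upper bound, an entry from
  \<open>N\<close> added to the blocking tuple excludes mates in \<open>N\<close> too.\<close>

lemma spread_eq_card:
  assumes g: "supplement g" and p: "Factorial_Ring.prime (ord g)"
  shows "spread G = card N"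
  unfolding spread_def
proof (rule Greatest_equality)
  have gc: "g \<in> carrier G" using g by simp
  show "\<forall>x\<in>{..<card N} \<rightarrow> carrier G - {\<one>}. \<exists>y\<in>carrier G. \<forall>i<card N. generate G {x i, y} = carrier G"
  proof
    fix x assume x: "x \<in> {..<card N} \<rightarrow> carrier G - {\<one>}"
    have xi: "x i \<in> carrier G" "x i \<noteq> \<one>" if "i < card N" for i using x that by (auto simp: Pi_iff)
    show "\<exists>y\<in>carrier G. \<forall>i<card N. generate G {x i, y} = carrier G"
    proof (cases "\<exists>n \<in> N. \<forall>i<card N. x i \<notin> generate G {n \<otimes> g \<otimes> inv n}")
      case True
      then obtain n where n: "n \<in> N" "\<And>i. i < card N \<Longrightarrow> x i \<notin> generate G {n \<otimes> g \<otimes> inv n}" by blast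
      have "generate G {x i, n \<otimes> g \<otimes> inv n} = carrier G" if "i < card N" for i
        using generate_eq_carrier[OF supplement_conj[OF g n(1)] xi(1)[OF that] n(2)[OF that]] .
      moreover have "n \<otimes> g \<otimes> inv n \<in> carrier G" using supplement_conj[OF g n(1)] by simp
      ultimately show ?thesis by blast
    next
      case False
      obtain a where a: "a \<in> N" "a \<noteq> \<one>" by (rule nontrivial_in_N)
      have "generate G {x i, a} = carrier G" if i: "i < card N" for i
      proof -
        \<comment> \<open>The entries other than \<open>x i\<close> miss some conjugate; since no
          conjugate is missed by all, \<open>x i\<close> lies in this one.\<close>
        have "card ({..<card N} - {i}) < card N" using i by simp
        then obtain n where n: "n \<in> N"
          "\<And>j. j \<in> {..<card N} - {i} \<Longrightarrow> x j \<notin> generate G {n \<otimes> g \<otimes> inv n}"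
          using avoid_conj_cyclic[OF g, of "{..<card N} - {i}" x] xi by auto
        obtain j where j: "j < card N" "x j \<in> generate G {n \<otimes> g \<otimes> inv n}" using False n(1) by blast
        then have "x i \<in> generate G {n \<otimes> g \<otimes> inv n}" using n(2)[of j] by (cases "j = i") simp_all
        then obtain l where l: "x i = n \<otimes> g [^] (l::nat) \<otimes> inv n"
          using mem_cyclic_conj_iff[OF gc n(1)] by blast
        let ?h = "g [^] l"
        have hc: "?h \<in> carrier G" using gc by simp
        have h1: "?h \<noteq> \<one>" using l xi(2)[OF i] mem_carrier[OF n(1)] by auto
        have hg: "?h \<in> generate G {g}" using generate_nat_pow[OF gc] by auto
        \<comment> \<open>A nontrivial element of a group of prime order generates it, so
          \<open>?h\<close> is a supplement like \<open>g\<close>.\<close>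
        have "ord ?h dvd ord g"
          using ord_pow_gen[OF gc, of l] by (auto simp: div_dvd_iff_mult)
        moreover have "ord ?h \<noteq> 1" using ord_eq_1[OF hc] h1 by simp
        ultimately have "ord ?h = ord g" using p by (metis prime_nat_iff)
        then have "card (generate G {?h}) = card (generate G {g})"
          using generate_pow_card[OF hc] generate_pow_card[OF gc] by simp
        moreover have "generate G {?h} \<subseteq> generate G {g}"
          using generate_subgroup_incl[OF _ subgroup_cyclic[OF gc]] hg by simp
        moreover have "finite (generate G {g})"
          using finite_subset[OF generate_incl finite_carrier] gc by simp
        ultimately have eq: "generate G {?h} = generate G {g}" by (simp add: card_subset_eq)
        have "supplement ?h" using g hc eq by (simp add: supplement_def)
        then have sx: "supplement (x i)" using supplement_conj n(1) l by simp
        have "a \<notin> generate G {x i}" using cyclic_Int_N[OF sx] a by blast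
        then show ?thesis using generate_eq_carrier[OF sx _, of a] a mem_carrier by (simp add: insert_commute)
      qed
      then show ?thesis using a mem_carrier by blast
    qed
  qed
next
  fix k :: nat assume mates: "\<forall>x\<in>{..<k} \<rightarrow> carrier G - {\<one>}. \<exists>y\<in>carrier G. \<forall>i<k. generate G {x i, y} = carrier G"
  show "k \<le> card N"
  proof (rule ccontr)
    assume "\<not> k \<le> card N"
    then have k: "card N \<le> k" "card N < k" by simp_all
    obtain x where x: "x \<in> {..<k} \<rightarrow> carrier G - {\<one>}"
        "\<And>y. y \<in> carrier G - N \<Longrightarrow> \<exists>i<k. generate G {x i, y} \<noteq> carrier G" "x (card N) \<in> N"
      using blocking_tuple[OF g generate.incl[OF singletonI] supplement_neq_one[OF g] k(1)] k(2) by metis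
    obtain y where y: "y \<in> carrier G" "\<forall>i<k. generate G {x i, y} = carrier G"
      using mates x(1) by blast
    have "y \<in> N" using x(2)[of y] y by blast
    then have "supplement (x (card N))"
      using supplement_if_generate[of "x (card N)" y] y(2) k(2) x(3) mem_carrier by simp
    then show False using not_supplement_if_in x(3) by simp
  qed
qed

text \<open>Here the complement has a nontrivial element \<open>h\<close> generating a proper
  subgroup. Conjugates of \<open>h\<close> block mates outside \<open>N\<close> as before, and mates
  inside \<open>N\<close> as well, because \<open>h\<close> does not generate
  \<open>G/N\<close>.\<close>

lemma spread_eq_card_minus_1:
  assumes g: "supplement g" and p: "\<not> Factorial_Ring.prime (ord g)"
  shows "spread G = card N - 1"
  unfolding spread_def
proof (rule Greatest_equality)
  show "\<forall>x\<in>{..<card N - 1} \<rightarrow> carrier G - {\<one>}. \<exists>y\<in>carrier G. \<forall>i<card N - 1. generate G {x i, y} = carrier G"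
    using spread_lower[OF g] by blast
next
  fix k :: nat assume mates: "\<forall>x\<in>{..<k} \<rightarrow> carrier G - {\<one>}. \<exists>y\<in>carrier G. \<forall>i<k. generate G {x i, y} = carrier G"
  have gc: "g \<in> carrier G" using g by simp
  \<comment> \<open>Not being prime gives a proper divisor only because
    \<open>ord g > 1\<close>.\<close>
  obtain d where d: "d dvd ord g" "d \<noteq> 1" "d \<noteq> ord g"
    using p ord_supplement_gt_1[OF g] by (auto simp: prime_nat_iff)
  have d0: "d > 0" using d(1) ord_supplement_gt_1[OF g] by (auto intro: Nat.gr0I)
  let ?h = "g [^] d"
  have hc: "?h \<in> carrier G" using gc by simp
  have hg: "?h \<in> generate G {g}" using generate_nat_pow[OF gc] by auto
  have ord_h: "ord ?h = ord g div d" using ord_pow_gen[OF gc, of d] d(1) d0 by (simp add: gcd_nat.absorb2)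
  have "ord ?h \<noteq> 1" using ord_h d by (metis dvd_mult_div_cancel mult.right_neutral)
  then have h1: "?h \<noteq> \<one>" by auto
  have "d > 1" using d0 d(2) by simp
  then have h_lt: "ord ?h < ord g" using ord_h ord_supplement_gt_1[OF g] by simp
  have h: "\<not> supplement ?h"
  proof
    assume "supplement ?h"
    then have "g \<in> generate G {?h}" by (rule supplement_mem_cyclic[OF g hg])
    then have "generate G {g} \<subseteq> generate G {?h}"
      using generate_subgroup_incl[OF _ subgroup_cyclic[OF hc]] by simp
    moreover have "finite (generate G {?h})"
      using finite_subset[OF generate_incl finite_carrier] hc by simp
    ultimately have "ord g \<le> ord ?h"
      using generate_pow_card[OF hc] generate_pow_card[OF gc] card_mono by metis
    with h_lt show False by simp
  qed
  show "k \<le> card N - 1"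
  proof (rule ccontr)
    assume "\<not> k \<le> card N - 1"
    then have k: "card N \<le> k" by simp
    obtain x where x: "x \<in> {..<k} \<rightarrow> carrier G - {\<one>}"
        "\<And>y. y \<in> carrier G - N \<Longrightarrow> \<exists>i<k. generate G {x i, y} \<noteq> carrier G" "\<exists>n \<in> N. x 0 = n \<otimes> ?h \<otimes> inv n"
      using blocking_tuple[OF g hg h1 k] by metis
    obtain n where n: "n \<in> N" "x 0 = n \<otimes> ?h \<otimes> inv n" using x(3) by blast
    obtain y where y: "y \<in> carrier G" "\<forall>i<k. generate G {x i, y} = carrier G"
      using mates x(1) by blast
    have yN: "y \<in> N" using x(2)[of y] y by blast
    have "0 < k" using k card_N by simp
    then have "generate G {x 0, y} = carrier G" using y(2) by blast
    moreover have "x 0 \<in> carrier G" using n hc mem_carrier by simp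
    ultimately have "supplement (x 0)" using yN by (rule supplement_if_generate)
    then have "supplement (inv n \<otimes> x 0 \<otimes> inv (inv n))" by (rule supplement_conj[OF _ inv_in_N[OF n(1)]])
    moreover have "inv n \<otimes> x 0 \<otimes> inv (inv n) = ?h"
      using conj_conj[of "inv n" n ?h] n hc mem_carrier by simp
    ultimately show False using h by simp
  qed
qed

section \<open>Dominating sets and the probability for pairs\<close>

lemma not_total_dominating_singleton: "\<not> total_dominating_set G {u}"
proof
  assume tds: "total_dominating_set G {u}"
  then have u: "u \<in> carrier G" "u \<noteq> \<one>" by (simp_all add: total_dominating_set_def)
  moreover have "\<forall>x \<in> carrier G - {\<one>}. generate G {x, u} = carrier G"
    using tds by (simp add: total_dominating_set_def)
  \<comment> \<open>The element \<open>u\<close> is itself nontrivial and has to be dominated by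
    \<open>u\<close>, which would make \<open>G\<close> cyclic.\<close>
  ultimately have "generate G {u, u} = carrier G" by blast
  then have gen: "generate G {u} = carrier G" by simp
  have "supplement u"
  proof (rule supplementI[OF u(1)])
    fix M assume "subgroup M G" "u \<in> M"
    then show "carrier G \<subseteq> M" using generate_subgroup_incl[of "{u}" M] gen by simp
  qed
  then show False using cyclic_neq_carrier gen by blast
qed

text \<open>A nontrivial element of \<open>N\<close> has to be dominated, and its mate must generate
  \<open>G/N\<close>.\<close>

lemma supplement_if_dominating:
  assumes "total_dominating_set G S"
  obtains y where "y \<in> S" "supplement y"
proof -
  obtain a where a: "a \<in> N" "a \<noteq> \<one>" by (rule nontrivial_in_N)
  then obtain y where y: "y \<in> S" "generate G {a, y} = carrier G"
    using assms mem_carrier unfolding total_dominating_set_def by blast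
  have "y \<in> carrier G" using assms y(1) unfolding total_dominating_set_def by blast
  then have "supplement y" using supplement_if_generate[of y a] y(2) a(1) by (simp add: insert_commute)
  with y(1) show ?thesis by (rule that)
qed

text \<open>The cyclic groups of two distinct conjugates meet trivially, so each nontrivial
  \<open>x\<close> lies outside one of them and generates \<open>G\<close> with its
  generator.\<close>

lemma uniform_dominating_pair_iff:
  assumes g: "supplement g" and u: "u \<in> conj_class G g" and v: "v \<in> conj_class G g"
  shows "uniform_dominating_set G {u, v} \<longleftrightarrow> u \<noteq> v"
proof
  assume "uniform_dominating_set G {u, v}"
  then show "u \<noteq> v" using not_total_dominating_singleton[of u] by (auto simp: uniform_dominating_set_def)
next
  assume uv: "u \<noteq> v"
  have su: "supplement u" and sv: "supplement v" using supplement_conj_class[OF g] u v by simp_all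
  obtain n where n: "n \<in> N" "u = n \<otimes> g \<otimes> inv n" using u conj_class_supplement[OF g] by auto
  obtain m where m: "m \<in> N" "v = m \<otimes> g \<otimes> inv m" using v conj_class_supplement[OF g] by auto
  have nm: "n \<noteq> m" using uv n m by auto
  have "\<exists>y \<in> {u, v}. generate G {x, y} = carrier G" if x: "x \<in> carrier G - {\<one>}" for x
  proof -
    have "x \<notin> generate G {u} \<or> x \<notin> generate G {v}"
      using conj_cyclic_disjoint[OF g n(1) m(1), of x] x nm n(2) m(2) by auto
    then show ?thesis using generate_eq_carrier[OF su, of x] generate_eq_carrier[OF sv, of x] x by auto
  qed
  then have "total_dominating_set G {u, v}"
    using su sv supplement_neq_one by (simp add: total_dominating_set_def)
  moreover have "y \<in> conj_class G x" if "x \<in> {u, v}" "y \<in> {u, v}" for x y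
  proof -
    have sx: "supplement x" using that(1) su sv by auto
    have xy: "x \<in> conj_class G g" "y \<in> conj_class G g" using that u v by auto
    obtain a where a: "a \<in> carrier G" "y = a \<otimes> g \<otimes> inv a" using xy(2) by (auto simp: conj_class_def)
    have "g \<in> conj_class G x" using conj_class_sym[OF supplement_closed[OF g] xy(1)] .
    then obtain b where b: "b \<in> carrier G" "g = b \<otimes> x \<otimes> inv b" by (auto simp: conj_class_def)
    have "y = (a \<otimes> b) \<otimes> x \<otimes> inv (a \<otimes> b)" using conj_conj[of a b x] a b sx by simp
    then show ?thesis using a(1) b(1) unfolding conj_class_def by blast
  qed
  ultimately show "uniform_dominating_set G {u, v}" unfolding uniform_dominating_set_def by blast
qed

lemma uniform_domination_number_eq:
  assumes g: "supplement g"
  shows "uniform_domination_number G = 2"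
  unfolding uniform_domination_number_def
proof (rule Least_equality)
  obtain a where a: "a \<in> N" "a \<noteq> \<one>" by (rule nontrivial_in_N)
  let ?v = "a \<otimes> g \<otimes> inv a"
  have gv: "g \<noteq> ?v"
    using inj_onD[OF conj_inj[OF g], of \<one> a] a one_in_N g by auto
  have "g \<in> conj_class G g" using conj_class_self g by simp
  moreover have "?v \<in> conj_class G g" using conj_class_supplement[OF g] a(1) by simp
  ultimately have "uniform_dominating_set G {g, ?v}"
    using uniform_dominating_pair_iff[OF g] gv by simp
  then show "\<exists>S. finite S \<and> uniform_dominating_set G S \<and> card S = 2"
    using gv by (intro exI[of _ "{g, ?v}"]) simp
next
  fix n assume "\<exists>S. finite S \<and> uniform_dominating_set G S \<and> card S = n"
  then obtain S where S: "finite S" "total_dominating_set G S" "card S = n"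
    by (auto simp: uniform_dominating_set_def)
  have "S \<noteq> {}" using supplement_if_dominating[OF S(2)] by blast
  then have "n \<noteq> 0" using S by auto
  moreover have "n \<noteq> 1" using S not_total_dominating_singleton by (auto simp: card_1_singleton_iff)
  ultimately show "2 \<le> n" by simp
qed

text \<open>The dominating pairs are exactly the pairs off the diagonal \<open>?D\<close> in a class
  of size \<open>|N|\<close>.\<close>

lemma uds_prob_supplement:
  assumes g: "supplement g"
  shows "uds_prob G g 2 = 1 - 1 / real (card N)"
proof -
  let ?C = "conj_class G g" and ?c = "card N"
  let ?P = "{..<2::nat} \<rightarrow>\<^sub>E ?C"
  let ?D = "(\<lambda>u. \<lambda>i\<in>{..<2::nat}. u) ` ?C"
  have fin: "finite ?C" using finite_N conj_class_supplement[OF g] by simp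
  have 2: "{..<2::nat} = {0, 1}" by auto
  have "{x \<in> ?P. uniform_dominating_set G (x ` {..<2})} = {x \<in> ?P. x 0 \<noteq> x 1}"
    using uniform_dominating_pair_iff[OF g] by (auto simp: 2 PiE_iff)
  also have "\<dots> = ?P - ?D"
  proof -
    have "x \<in> ?D" if "x \<in> ?P" "x 0 = x 1" for x
    proof (rule image_eqI)
      show "x 0 \<in> ?C" using that(1) by (auto simp: PiE_iff)
      show "x = (\<lambda>i\<in>{..<2}. x 0)"
        using that by (auto simp: fun_eq_iff PiE_iff extensional_def restrict_def less_2_cases_iff)
    qed
    moreover have "x 0 = x 1" if "x \<in> ?D" for x using that by (elim imageE) simp
    ultimately show ?thesis by blast
  qed
  also have "card (?P - ?D) = card ?P - card ?D"
    by (rule card_Diff_subset) (use fin in \<open>auto split: if_splits\<close>)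
  also have "card ?P = ?c ^ 2" using fin by (simp add: card_PiE card_conj_class[OF g])
  also have "card ?D = ?c"
  proof -
    have "inj_on (\<lambda>u. \<lambda>i\<in>{..<2::nat}. u) ?C"
      by (rule inj_onI) (metis lessThan_iff restrict_apply zero_less_numeral)
    then show ?thesis by (simp add: card_image card_conj_class[OF g])
  qed
  finally have "uds_prob G g 2 = real (?c ^ 2 - ?c) / real ?c ^ 2"
    by (simp add: uds_prob_def card_conj_class[OF g])
  \<comment> \<open>The natural subtraction is exact, since \<open>?c \<le> ?c ^ 2\<close>.\<close>
  also have "\<dots> = 1 - 1 / real ?c"
    using card_N by (simp add: of_nat_diff power2_eq_square field_simps)
  finally show ?thesis .
qed

text \<open>A dominating set contains a supplement, and being a supplement is invariant under
  conjugation.\<close>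

lemma uds_prob_not_supplement:
  assumes "s \<in> carrier G" "\<not> supplement s"
  shows "uds_prob G s 2 = 0"
proof -
  have "\<not> uniform_dominating_set G (x ` {..<2})" if x: "x \<in> {..<2::nat} \<rightarrow>\<^sub>E conj_class G s" for x
  proof
    assume "uniform_dominating_set G (x ` {..<2})"
    then obtain y where y: "y \<in> x ` {..<2}" "supplement y"
      using supplement_if_dominating unfolding uniform_dominating_set_def by blast
    have "y \<in> conj_class G s" using x y(1) by (auto simp: PiE_iff)
    then have "s \<in> conj_class G y" by (rule conj_class_sym[OF assms(1)])
    then show False using supplement_conj_class[OF y(2)] assms(2) by blast
  qed
  then have "{x \<in> {..<2::nat} \<rightarrow>\<^sub>E conj_class G s. uniform_dominating_set G (x ` {..<2})} = {}" by blast
  then show ?thesis unfolding uds_prob_def by (simp only: card.empty)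
qed

lemma max_uds_prob_eq:
  assumes g: "supplement g"
  shows "max_uds_prob G 2 = 1 - 1 / real (card N)"
  unfolding max_uds_prob_def
proof (rule Max_eqI)
  show "finite ((\<lambda>s. uds_prob G s 2) ` carrier G)" using finite_carrier by simp
  show "1 - 1 / real (card N) \<in> (\<lambda>s. uds_prob G s 2) ` carrier G"
    using uds_prob_supplement[OF g] supplement_closed[OF g] by (metis imageI)
  fix q assume "q \<in> (\<lambda>s. uds_prob G s 2) ` carrier G"
  then obtain s where s: "s \<in> carrier G" "q = uds_prob G s 2" by blast
  have "1 - 1 / real (card N) \<ge> 0" using card_N by (simp add: field_simps)
  then show "q \<le> 1 - 1 / real (card N)"
    using s uds_prob_supplement[of s] uds_prob_not_supplement[of s] by (cases "supplement s") simp_all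
qed

section \<open>Structure of the semidirect product\<close>

lemma comm_group_N: "comm_group (G\<lparr>carrier := N\<rparr>)"
  using subgroup_imp_group[OF subgroup_axioms] N_comm
  by (intro group.group_comm_groupI) simp_all

text \<open>For a prime \<open>p\<close> dividing the order of some element of \<open>N\<close>, the
  solutions of \<open>x [^] p = \<one>\<close> in \<open>N\<close> form a nontrivial normal subgroup
  of \<open>G\<close>, hence all of \<open>N\<close>.\<close>

lemma elementary_abelian_N:
  obtains p f :: nat where "Factorial_Ring.prime p" "f \<ge> 1"
    "G\<lparr>carrier := N\<rparr> \<cong> product_group {..<f} (\<lambda>_. integer_mod_group p)"
proof -
  obtain a where a: "a \<in> N" "a \<noteq> \<one>" by (rule nontrivial_in_N)
  have ac: "a \<in> carrier G" using a mem_carrier by simp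
  have ord_a: "ord a \<noteq> 1" using ord_eq_1[OF ac] a by simp
  then obtain p where p: "Factorial_Ring.prime p" "p dvd ord a" using prime_factor_nat by blast
  let ?K = "{x \<in> N. x [^] p = \<one>}"
  obtain y where y: "y \<in> ?K" "y \<noteq> \<one>"
  proof -
    \<comment> \<open>This power of \<open>a\<close> has order \<open>p\<close>.\<close>
    let ?y = "a [^] (ord a div p)"
    have yc: "?y \<in> N"
      using subgroup_int_pow_closed[OF subgroup_axioms a(1), of "int (ord a div p)"]
      by (simp add: int_pow_int)
    have "?y [^] p = a [^] ord a" using ac p(2) by (simp add: nat_pow_pow)
    moreover have "?y \<noteq> \<one>"
    proof
      assume "?y = \<one>"
      then have "ord a dvd ord a div p" using pow_eq_id[OF ac] by simp
      moreover have "ord a div p > 0" "ord a div p < ord a"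
        using p ord_ge_1[OF finite_carrier ac] prime_gt_1_nat[OF p(1)]
        by (auto simp: div_greater_zero_iff dvd_imp_le)
      ultimately show False using nat_dvd_not_less by blast
    qed
    ultimately show ?thesis using that[of ?y] yc pow_ord_eq_1[OF ac] by simp
  qed
  have "?K \<lhd> G"
  proof (rule normal_invI)
    show "subgroup ?K G"
    proof (rule subgroupI)
      show "?K \<subseteq> carrier G" using mem_carrier by auto
      show "?K \<noteq> {}" using y by blast
      fix u assume u: "u \<in> ?K"
      then show "inv u \<in> ?K" using mem_carrier nat_pow_inv[of u p] inv_in_N by simp
      fix v assume v: "v \<in> ?K"
      show "u \<otimes> v \<in> ?K"
        using u v mem_carrier mult_in_N N_comm[of u v] pow_mult_distrib[of u v p] by simp
    qed
    fix x h assume x: "x \<in> carrier G" and h: "h \<in> ?K"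
    then show "x \<otimes> h \<otimes> inv x \<in> ?K"
      using conj_in_N[OF x] pow_conj[OF x mem_carrier, of h p] by simp
  qed
  moreover have "?K \<noteq> {\<one>}" using y by blast
  ultimately have NK: "N \<subseteq> ?K" by (rule minimal)
  interpret C: comm_group "G\<lparr>carrier := N\<rparr>" by (rule comm_group_N)
  obtain f :: nat where f: "G\<lparr>carrier := N\<rparr> \<cong> product_group {..<f} (\<lambda>_. integer_mod_group p)"
  proof (rule C.elementary_abelian_iso[OF _ p(1)])
    show "finite (carrier (G\<lparr>carrier := N\<rparr>))" using finite_N by simp
    fix x assume "x \<in> carrier (G\<lparr>carrier := N\<rparr>)"
    then show "x [^]\<^bsub>G\<lparr>carrier := N\<rparr>\<^esub> p = \<one>\<^bsub>G\<lparr>carrier := N\<rparr>\<^esub>"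
      using NK by (auto simp flip: nat_pow_consistent)
  qed
  have "f \<noteq> 0"
  proof
    assume "f = 0"
    then have "card N = 1" using iso_same_card[OF f] by simp
    then show False using card_N by simp
  qed
  then show ?thesis using p(1) f by (intro that[of p f]) simp_all
qed

lemma obtain_supplement:
  assumes "cyclic_group (G Mod N)"
  obtains g where "supplement g"
proof -
  interpret Q: group "G Mod N" by (rule factorgroup_is_group)
  obtain Y where Y: "Y \<in> carrier (G Mod N)" "carrier (G Mod N) = range (\<lambda>n::int. Y [^]\<^bsub>G Mod N\<^esub> n)"
    using assms Q.cyclic_group by blast
  obtain g where g: "g \<in> carrier G" "Y = N #> g" using Y(1) by (auto simp: FactGroup_def RCOSETS_def)
  have "supplement g"
  proof (rule supplementI[OF g(1)])
    fix M assume M: "subgroup M G" "N \<subseteq> M" "g \<in> M"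
    show "carrier G \<subseteq> M"
    proof
      fix x assume x: "x \<in> carrier G"
      then have "N #> x \<in> carrier (G Mod N)" by (auto simp: FactGroup_def RCOSETS_def)
      then obtain k :: int where "N #> x = Y [^]\<^bsub>G Mod N\<^esub> k" using Y(2) by auto
      then have "N #> x = N #> (g [^] k)" using FactGroup_int_pow[OF g(1)] g(2) by simp
      then have "x \<in> N #> (g [^] k)" using rcos_self[OF x subgroup_axioms] by simp
      then obtain n where "n \<in> N" "x = n \<otimes> g [^] k" by (auto simp: r_coset_def)
      moreover have "g [^] k \<in> M" by (rule subgroup_int_pow_closed[OF M(1,3)])
      ultimately show "x \<in> M" using subgroup.m_closed[OF M(1)] subsetD[OF M(2)] by simp
    qed
  qed
  then show ?thesis by (rule that)
qed

section \<open>The complement and its action on \<open>N\<close>\<close>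

lemma internal_semidirect_product_cyclic:
  assumes g: "supplement g"
  shows "internal_semidirect_product G N (generate G {g})"
proof -
  have H: "subgroup (generate G {g}) G" using g by (simp add: subgroup_cyclic)
  have "N \<inter> generate G {g} = {\<one>}"
    using cyclic_Int_N[OF g] one_in_N subgroup.one_closed[OF H] by blast
  then show ?thesis
    using g H normal_axioms by (simp add: internal_semidirect_product_def supplement_def)
qed

lemma faithful_action_conj:
  assumes g: "supplement g"
  shows "faithful_action (G\<lparr>carrier := generate G {g}\<rparr>) N (conj_action G N)"
proof -
  let ?H = "generate G {g}"
  have gc: "g \<in> carrier G" using g by simp
  have H: "subgroup ?H G" by (rule subgroup_cyclic[OF gc])
  have Hc: "h \<in> carrier G" if "h \<in> ?H" for h using subgroup.mem_carrier[OF H that] .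
  have bij: "conj_action G N h \<in> Bij N" if "h \<in> carrier G" for h
  proof -
    have "inj_on (\<lambda>n. h \<otimes> n \<otimes> inv h) N"
      using that mem_carrier by (intro inj_onI) simp
    moreover have "(\<lambda>n. h \<otimes> n \<otimes> inv h) ` N \<subseteq> N" using conj_in_N[OF that] by blast
    ultimately have "bij_betw (\<lambda>n. h \<otimes> n \<otimes> inv h) N N"
      using endo_inj_surj[OF finite_N] by (simp add: bij_betw_def)
    then have "bij_betw (conj_action G N h) N N"
      unfolding conj_action_def by (simp cong: bij_betw_cong)
    then show ?thesis by (simp add: Bij_def conj_action_def)
  qed
  have "conj_action G N \<in> hom (G\<lparr>carrier := ?H\<rparr>) (BijGroup N)"
  proof (rule homI)
    fix h assume "h \<in> carrier (G\<lparr>carrier := ?H\<rparr>)"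
    then show "conj_action G N h \<in> carrier (BijGroup N)" using bij[of h] Hc by (simp add: BijGroup_def)
  next
    fix h k assume "h \<in> carrier (G\<lparr>carrier := ?H\<rparr>)" "k \<in> carrier (G\<lparr>carrier := ?H\<rparr>)"
    then have h: "h \<in> carrier G" and k: "k \<in> carrier G" using Hc by simp_all
    have "conj_action G N (h \<otimes> k) = compose N (conj_action G N h) (conj_action G N k)"
      using conj_conj[OF h k] conj_in_N[OF k] mem_carrier
      by (auto simp: conj_action_def compose_def fun_eq_iff)
    then show "conj_action G N (h \<otimes>\<^bsub>G\<lparr>carrier := ?H\<rparr>\<^esub> k)
        = conj_action G N h \<otimes>\<^bsub>BijGroup N\<^esub> conj_action G N k"
      using bij[OF h] bij[OF k] by (simp add: BijGroup_def)
  qed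
  moreover have "inj_on (conj_action G N) ?H"
  proof (rule inj_onI)
    fix h k assume h: "h \<in> ?H" and k: "k \<in> ?H" and eq: "conj_action G N h = conj_action G N k"
    have [simp]: "h \<in> carrier G" "k \<in> carrier G" using Hc h k by simp_all
    \<comment> \<open>Equal actions of \<open>h\<close> and \<open>k\<close> make \<open>?z\<close>
      centralize \<open>N\<close>; it also commutes with \<open>g\<close>, so it is central.\<close>
    let ?z = "inv k \<otimes> h"
    have z: "?z \<in> ?H" using h k subgroup.m_closed[OF H] subgroup.m_inv_closed[OF H] by simp
    have "?z = \<one>"
    proof (rule center_trivial[OF g])
      show "?z \<in> carrier G" by simp
      obtain i where "?z = g [^] (i::nat)" using z generate_nat_pow[OF gc] by auto
      then show "?z \<otimes> g = g \<otimes> ?z" using gc by (metis nat_pow_Suc nat_pow_Suc2)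
      fix n assume n: "n \<in> N"
      have nc: "n \<in> carrier G" using mem_carrier[OF n] .
      have "h \<otimes> n \<otimes> inv h = k \<otimes> n \<otimes> inv k" using fun_cong[OF eq, of n] n by (simp add: conj_action_def)
      then have "?z \<otimes> n \<otimes> inv ?z = inv k \<otimes> (k \<otimes> n \<otimes> inv k) \<otimes> inv (inv k)"
        using conj_conj[of "inv k" h n] nc by simp
      also have "\<dots> = n" using conj_conj[of "inv k" k n] nc by simp
      finally show "?z \<otimes> n = n \<otimes> ?z" using conj_eq_self_iff[of ?z n] nc by simp
    qed
    then have "inv h = inv k" by (rule inv_equality) simp_all
    then have "inv (inv h) = inv (inv k)" by simp
    then show "h = k" by simp
  qed
  ultimately show ?thesis
    using subgroup_imp_group[OF H] group_BijGroup
    by (intro faithful_action.intro group_action.intro group_hom.intro group_hom_axioms.intro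
        faithful_action_axioms.intro) simp_all
qed

lemma acts_irreducibly_cyclic:
  assumes g: "supplement g"
  shows "acts_irreducibly G (generate G {g}) N"
  unfolding acts_irreducibly_def
proof (intro conjI allI impI)
  fix K assume K: "subgroup K G \<and> K \<subseteq> N \<and> (\<forall>h \<in> generate G {g}. conj_action G N h ` K \<subseteq> K)"
  \<comment> \<open>Invariance under \<open>g\<close> already makes \<open>K\<close> normal in
    \<open>G\<close>, and minimality of \<open>N\<close> applies.\<close>
  then have "conj_action G N g ` K \<subseteq> K" using generate.incl[of g "{g}" G] by simp
  then have "g \<otimes> k \<otimes> inv g \<in> K" if "k \<in> K" for k
    using K that by (auto simp: conj_action_def subset_iff image_iff)
  then have "K \<lhd> G" using K normal_in_N[OF g, of K] by simp
  then show "K = {\<one>} \<or> K = N" using minimal[of K] K by blast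
qed (rule nontriv)

end

section \<open>From solubility and cyclic quotients to the monolith\<close>

theorem theorem1:
  fixes G :: "('a, 'b) monoid_scheme"
  assumes "group G"
    and "finite (carrier G)"
    and "\<not> comm_group G"
    and "solvable G"
    and "\<And>K. K \<lhd> G \<Longrightarrow> K \<noteq> {\<one>\<^bsub>G\<^esub>} \<Longrightarrow> cyclic_group (G Mod K)"
  shows "\<exists>N H (p::nat) (f::nat).
    internal_semidirect_product G N H \<and>
    Factorial_Ring.prime p \<and> f \<ge> 1 \<and>
    G\<lparr>carrier := N\<rparr> \<cong> product_group {..<f} (\<lambda>_. integer_mod_group p) \<and>
    cyclic_group (G\<lparr>carrier := H\<rparr>) \<and>
    faithful_action (G\<lparr>carrier := H\<rparr>) N (conj_action G N) \<and>
    acts_irreducibly G H N \<and>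
    int (spread G) = int (card N) - (if Factorial_Ring.prime (card H) then 0 else 1) \<and>
    int (uniform_spread G) = int (card N) - 1 \<and>
    uniform_domination_number G = 2 \<and>
    max_uds_prob G 2 = 1 - 1 / real (card N)"
proof -
  interpret group G by fact
  let ?N = "derived G (carrier G)"
  have normal: "?N \<lhd> G" by (rule derived_self_is_normal)
  have nontriv: "?N \<noteq> {\<one>\<^bsub>G\<^esub>}"
  proof
    assume "?N = {\<one>\<^bsub>G\<^esub>}"
    then have "comm_group G"
      using commute_if_derived_trivial[OF subset_refl] by (intro group_comm_groupI) simp
    then show False using assms(3) by simp
  qed
  \<comment> \<open>The quotient by \<open>K\<close> is cyclic, hence abelian, so \<open>K\<close>
    contains all commutators.\<close>
  have minimal: "?N \<subseteq> K" if "K \<lhd> G" "K \<noteq> {\<one>\<^bsub>G\<^esub>}" for K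
    using derived_minimal[OF that(1)] group.cyclic_imp_abelian_group[OF normal.factorgroup_is_group[OF that(1)] assms(5)[OF that]] by simp
  have N_sub: "?N \<subseteq> carrier G" by (rule derived_in_carrier[OF subset_refl])
  \<comment> \<open>Otherwise minimality gives \<open>derived G ?N = ?N\<close>, and the derived
    series of \<open>G\<close> could never drop below \<open>?N\<close>, against solubility.\<close>
  have "derived G ?N = {\<one>\<^bsub>G\<^esub>}"
  proof (rule ccontr)
    assume "derived G ?N \<noteq> {\<one>\<^bsub>G\<^esub>}"
    then have "?N \<subseteq> derived G ?N" using minimal derived_is_normal[OF normal] by simp
    moreover have "derived G ?N \<subseteq> ?N"
      using derived_incl[OF subset_refl derived_is_subgroup[OF subset_refl]] .
    ultimately have fixed: "derived G ?N = ?N" by simp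
    obtain n where "(derived G ^^ n) (carrier G) = {\<one>\<^bsub>G\<^esub>}"
      using assms(4) solvable_iff_trivial_derived_seq by blast
    then have "(derived G ^^ n) ?N \<subseteq> {\<one>\<^bsub>G\<^esub>}" using mono_exp_of_derived[OF N_sub, of n] by simp
    then have "?N \<subseteq> {\<one>\<^bsub>G\<^esub>}" using funpow_derived_fixed[OF fixed] by simp
    then show False
      using nontriv subgroup.one_closed[OF derived_is_subgroup[OF subset_refl]] by blast
  qed
  then have comm: "x \<otimes>\<^bsub>G\<^esub> y = y \<otimes>\<^bsub>G\<^esub> x" if "x \<in> ?N" "y \<in> ?N" for x y
    using commute_if_derived_trivial[OF N_sub _ that] by simp
  interpret monolith ?N G
    by (intro monolith.intro monolith_axioms.intro normal assms(2,3) nontriv comm minimal)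
  obtain g where g: "supplement g" using obtain_supplement[OF assms(5)[OF normal nontriv]] .
  obtain p f :: nat where pf: "Factorial_Ring.prime p" "f \<ge> 1"
    "G\<lparr>carrier := ?N\<rparr> \<cong> product_group {..<f} (\<lambda>_. integer_mod_group p)"
    by (rule elementary_abelian_N)
  let ?H = "generate G {g}"
  have gc: "g \<in> carrier G" using g by simp
  have cyc: "cyclic_group (G\<lparr>carrier := ?H\<rparr>)"
    using cyclic_group_generated[of g] gc by (simp add: subgroup_generated_def)
  have "card ?H = ord g" using generate_pow_card[OF gc] by simp
  \<comment> \<open>Since \<open>card ?N > 1\<close>, the natural \<open>card ?N - 1\<close> agrees
    with the integer difference.\<close>
  then have "int (spread G) = int (card ?N) - (if Factorial_Ring.prime (card ?H) then 0 else 1)"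
    using spread_eq_card[OF g] spread_eq_card_minus_1[OF g] card_N by simp
  moreover have "int (uniform_spread G) = int (card ?N) - 1"
    using uniform_spread_eq[OF g] card_N by simp
  ultimately show ?thesis
    using internal_semidirect_product_cyclic[OF g] pf cyc faithful_action_conj[OF g]
      acts_irreducibly_cyclic[OF g] uniform_domination_number_eq[OF g] max_uds_prob_eq[OF g]
    by blast
qed

end
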